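(* Let $p\ge 5$ be a prime. Then there does not exist a $(4p,p,4p,4)$ relative difference set in $G=\mathbb{Z}_2^2\times\mathbb{Z}_p^2$ (relative to any subgroup of order $p$).
   Context: Let $G$ be a finite group of order $mn$ and $N$ a subgroup of order $n$. A $k$-subset $R$ of $G$ is an $(m,n,k,\lambda)$ relative difference set in $G$ relative to $N$ if every element $g\in G\setminus N$ has exactly $\lambda$ representations $g=r_1r_2^{-1}$ with $r_1,r_2\in R$, and no non-identity element of $N$ has such a representation. *)

theory Defs
  imports "HOL-Algebra.Elementary_Groups" "HOL-Computational_Algebra.Primes"
begin

definition relative_difference_set ::
  "('a, 'b) monoid_scheme \<Rightarrow> 'a set \<Rightarrow> nat \<Rightarrow> nat \<Rightarrow> nat \<Rightarrow> nat \<Rightarrow> 'a set \<Rightarrow> bool"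
where
  "relative_difference_set G N m n k l R \<longleftrightarrow>
     group G \<and> finite (carrier G) \<and> order G = m * n \<and>
     subgroup N G \<and> card N = n \<and>
     R \<subseteq> carrier G \<and> card R = k \<and>
     (\<forall>g \<in> carrier G - N.
        card {(r1, r2). r1 \<in> R \<and> r2 \<in> R \<and> g = r1 \<otimes>\<^bsub>G\<^esub> inv\<^bsub>G\<^esub> r2} = l) \<and>
     (\<forall>g \<in> N - {\<one>\<^bsub>G\<^esub>}.
        \<not> (\<exists>r1 \<in> R. \<exists>r2 \<in> R. g = r1 \<otimes>\<^bsub>G\<^esub> inv\<^bsub>G\<^esub> r2))"

definition Z22_Zpp :: "nat \<Rightarrow> ((int \<times> int) \<times> (int \<times> int)) monoid" where
  "Z22_Zpp p = (integer_mod_group 2 \<times>\<times> integer_mod_group 2) \<times>\<times>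
               (integer_mod_group p \<times>\<times> integer_mod_group p)"

lemma group_Z22_Zpp: "group (Z22_Zpp p)"
  by (simp add: Z22_Zpp_def DirProd_group)

lemma finite_carrier_Z22_Zpp: "p > 0 \<Longrightarrow> finite (carrier (Z22_Zpp p))"
  by (simp add: Z22_Zpp_def carrier_integer_mod_group)

lemma order_Z22_Zpp: "p > 0 \<Longrightarrow> order (Z22_Zpp p) = (4 * p) * p"
  by (simp add: Z22_Zpp_def order_def carrier_integer_mod_group card_cartesian_product)

end

theory Submission
  imports Defs "HOL-Number_Theory.Number_Theory" "HOL-Computational_Algebra.Polynomial"
begin

text \<open>
  In suitable coordinates the forbidden subgroup is the last factor of \<open>\<int>\<^sub>2\<^sup>2 \<times> \<int>\<^sub>p \<times> \<int>\<^sub>p\<close>, and a relative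
  difference set is the union of the graphs of four functions \<open>f\<^sub>e : \<int>\<^sub>p \<rightarrow> \<int>\<^sub>p\<close>, one for each \<open>e \<in> \<int>\<^sub>2\<^sup>2\<close>.

  Fix a slope \<open>a\<close> and let \<open>c\<^sub>e(k)\<close> count the solutions of \<open>f\<^sub>e(x) + a x = k\<close>. The character sums of
  the \<open>c\<^sub>e\<close> have absolute value \<open>2\<surd>p\<close>; dividing them by the quadratic Gauss sum, which is possible
  integrally because low power moments vanish modulo \<open>p\<close>, gives \<open>c\<^sub>e = 1 + U\<^sub>e * \<chi>\<close> with \<open>\<chi>\<close> the
  quadratic character and integer functions \<open>U\<^sub>e\<close> whose total square sum is 4. Nonnegativity of
  \<open>c\<^sub>e\<close> forces each \<open>U\<^sub>e\<close> to be plus or minus a point mass, say at \<open>d\<^sub>e(a)\<close>, and the correlations of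
  the \<open>U\<^sub>e\<close> force the four points \<open>d\<^sub>e(a)\<close> to coincide in pairs.

  The resulting value distribution of \<open>f\<^sub>e(x) + a x\<close> for all \<open>a\<close> makes \<open>f\<^sub>e\<close> quadratic, by the argument
  of Ronyai and Szonyi on planar functions, and then \<open>d\<^sub>e(a)\<close> is a quadratic polynomial in \<open>a\<close> that determines \<open>f\<^sub>e\<close>.
  Four pairwise different quadratics cannot coincide in pairs at all \<open>p \<ge> 5\<close> points.
\<close>

section \<open>Sums over the integers modulo a prime\<close>

locale prime_ge_5 =
  fixes p :: nat
  assumes prime_p: "prime p" and p_ge_5: "5 \<le> p"
begin

abbreviation Zp :: "int set" where "Zp \<equiv> {0..<int p}"

text \<open>Functions on the residue field are modelled by functions on the integers that respect
  congruence modulo \<open>p\<close>, so shifted or reflected arguments need no reduction.\<close>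

definition periodic :: "(int \<Rightarrow> 'b) \<Rightarrow> bool" where
  "periodic f \<longleftrightarrow> (\<forall>x y. [x = y] (mod int p) \<longrightarrow> f x = f y)"

lemma periodicD: "periodic f \<Longrightarrow> [x = y] (mod int p) \<Longrightarrow> f x = f y"
  by (auto simp: periodic_def)

lemma periodic_mod: "periodic f \<Longrightarrow> f (x mod int p) = f x"
  by (erule periodicD) (simp add: cong_def)

lemma mod_in_Zp [simp]: "x mod int p \<in> Zp"
  using p_ge_5 by simp

lemma Zp_cong_eq: "x \<in> Zp \<Longrightarrow> y \<in> Zp \<Longrightarrow> [x = y] (mod int p) \<Longrightarrow> x = y"
  by (simp add: cong_def)

lemma sum_reindex_cong:
  fixes f :: "int \<Rightarrow> 'b::comm_monoid_add"
  assumes f: "periodic f" and inj: "\<And>x y. [h x = h y] (mod int p) \<Longrightarrow> [x = y] (mod int p)"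
  shows "(\<Sum>k\<in>Zp. f (h k)) = (\<Sum>k\<in>Zp. f k)"
proof -
  let ?h = "\<lambda>k. h k mod int p"
  have i: "inj_on ?h Zp"
    by (rule inj_onI) (metis Zp_cong_eq cong_def inj)
  have "?h ` Zp = Zp"
    by (rule endo_inj_surj) (use i mod_in_Zp in auto)
  then have "bij_betw ?h Zp Zp" using i by (simp add: bij_betw_def)
  then have "(\<Sum>k\<in>Zp. f (?h k)) = (\<Sum>k\<in>Zp. f k)"
    by (rule sum.reindex_bij_betw)
  then show ?thesis by (simp add: periodic_mod[OF f])
qed

lemma sum_shift: "periodic f \<Longrightarrow> (\<Sum>k\<in>Zp. f (k + t)) = (\<Sum>k\<in>Zp. f k :: 'b::comm_monoid_add)"
  by (rule sum_reindex_cong) (auto simp: cong_add_rcancel)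

lemma sum_reflect: "periodic f \<Longrightarrow> (\<Sum>k\<in>Zp. f (t - k)) = (\<Sum>k\<in>Zp. f k :: 'b::comm_monoid_add)"
  by (rule sum_reindex_cong) (auto simp: cong_iff_dvd_diff dvd_diff_commute)

lemma sum_Zp_delta:
  fixes f :: "int \<Rightarrow> 'b::semiring_1"
  assumes "periodic f"
  shows "(\<Sum>k\<in>Zp. f k * of_bool ([k = d] (mod int p))) = f d"
proof -
  have "(\<Sum>k\<in>Zp. f k * of_bool ([k = d] (mod int p))) = (\<Sum>k\<in>Zp. if k = d mod int p then f k else 0)"
    by (rule sum.cong) (auto simp: cong_def)
  also have "\<dots> = f (d mod int p)" using p_ge_5 by simp
  finally show ?thesis by (simp add: periodic_mod assms)
qed

section \<open>Divisibility by \<open>p\<close> and power sums\<close>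

lemma not_dvd_small: "0 < n \<Longrightarrow> n < p \<Longrightarrow> \<not> int p dvd int n"
  by (simp add: nat_dvd_not_less)

lemma prime_int_p: "prime (int p)"
  using prime_p by simp

lemma dvd_double_imp_dvd: "int p dvd 2 * x \<Longrightarrow> int p dvd x"
  using prime_int_p not_dvd_small[of 2] p_ge_5 by (auto simp: prime_dvd_mult_iff)

lemma sum_Zp_eq_nat: "(\<Sum>k\<in>Zp. f k) = (\<Sum>k<p. f (int k))"
proof -
  have "Zp = int ` {..<p}" by (simp add: image_int_atLeastLessThan lessThan_atLeast0)
  then show ?thesis by (simp add: sum.reindex)
qed

text \<open>Telescoping \<open>(k + 1) ^ (m + 1) - k ^ (m + 1)\<close> and expanding expresses
  \<open>m + 1\<close> times this sum by lower power sums and a power of \<open>p\<close>; as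
  \<open>m + 1 < p\<close>, the factor can be cancelled.\<close>

lemma power_sum_cong_0: "m < p - 1 \<Longrightarrow> int p dvd (\<Sum>k\<in>Zp. k ^ m)"
proof (induction m rule: less_induct)
  case (less m)
  have "(\<Sum>k<p. (int (Suc k)) ^ (m+1) - int k ^ (m+1)) = int p ^ (m+1)"
    by (subst sum_lessThan_telescope) simp
  moreover have "(int (Suc k)) ^ (m+1) - int k ^ (m+1) = (\<Sum>i\<le>m. of_nat ((m+1) choose i) * int k ^ i)" for k
  proof -
    have "(int k + 1) ^ (m+1) = (\<Sum>i\<le>m+1. of_nat ((m+1) choose i) * int k ^ i)"
      by (subst binomial_ring) simp
    then show ?thesis by (simp add: add.commute)
  qed
  ultimately have "int p ^ (m+1) = (\<Sum>k<p. \<Sum>i\<le>m. of_nat ((m+1) choose i) * int k ^ i)" by simp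
  also have "\<dots> = (\<Sum>i\<le>m. of_nat ((m+1) choose i) * (\<Sum>k\<in>Zp. k ^ i))"
    by (subst sum.swap) (simp add: sum_distrib_left sum_Zp_eq_nat)
  also have "\<dots> = (\<Sum>i<m. of_nat ((m+1) choose i) * (\<Sum>k\<in>Zp. k ^ i)) + of_nat (m+1) * (\<Sum>k\<in>Zp. k ^ m)"
    by (simp add: lessThan_Suc_atMost[symmetric])
  finally have eq: "int (m+1) * (\<Sum>k\<in>Zp. k ^ m) = int p ^ (m+1) - (\<Sum>i<m. of_nat ((m+1) choose i) * (\<Sum>k\<in>Zp. k ^ i))"
    by simp
  have "int p dvd (\<Sum>i<m. of_nat ((m+1) choose i) * (\<Sum>k\<in>Zp. k ^ i))"
    by (rule dvd_sum) (use less in auto)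
  then have "int p dvd int (m+1) * (\<Sum>k\<in>Zp. k ^ m)"
    unfolding eq by (simp add: dvd_diff)
  moreover have "\<not> int p dvd int (m+1)" using less.prems by (intro not_dvd_small) auto
  ultimately show ?case using prime_int_p prime_dvd_mult_iff by blast
qed

lemma power_sum_top: "[(\<Sum>k\<in>Zp. k ^ (p - 1)) = -1] (mod int p)"
proof -
  have "[(\<Sum>k\<in>Zp. k ^ (p - 1)) = (\<Sum>k\<in>Zp. if k = 0 then 0 else 1)] (mod int p)"
  proof (rule cong_sum)
    fix k assume k: "k \<in> Zp"
    show "[k ^ (p - 1) = (if k = 0 then 0 else 1)] (mod int p)"
    proof (cases "k = 0")
      case True then show ?thesis using p_ge_5 by (simp add: power_0_left)
    next
      case False
      then have "\<not> p dvd nat k" using k by (auto dest: dvd_imp_le)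
      then have "[nat k ^ (p - 1) = 1] (mod p)" using fermat_theorem prime_p by blast
      then have "[int (nat k ^ (p - 1)) = int 1] (mod int p)" by (subst cong_int_iff)
      then show ?thesis using k False by simp
    qed
  qed
  also have "(\<Sum>k\<in>Zp. if k = 0 then 0 else (1::int)) = int p - 1"
    by (simp add: sum.If_cases Int_def[symmetric] sum.delta_remove)
       (use p_ge_5 in \<open>simp add: sum.If_cases card_Diff_subset Diff_eq[symmetric]\<close>)
  also have "[int p - 1 = -1] (mod int p)" by (simp add: cong_iff_dvd_diff)
  finally show ?thesis .
qed

lemma poly_eq_sum_coeff:
  fixes q :: "int poly"
  assumes "degree q \<le> n"
  shows "poly q x = (\<Sum>i\<le>n. coeff q i * x ^ i)"
  unfolding poly_altdef using assms
  by (intro sum.mono_neutral_left) (auto simp: coeff_eq_0)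

text \<open>Power sums of exponent below \<open>p - 1\<close> vanish modulo \<open>p\<close>, so
  only the top coefficient survives. Character sums are evaluated through this, with
  \<open>chi\<close> replaced by a power.\<close>

lemma sum_poly_cong:
  fixes q :: "int poly"
  assumes "degree q \<le> p - 1"
  shows "[(\<Sum>k\<in>Zp. poly q k) = - coeff q (p - 1)] (mod int p)"
proof -
  have "(\<Sum>k\<in>Zp. poly q k) = (\<Sum>i\<le>p-1. coeff q i * (\<Sum>k\<in>Zp. k ^ i))"
    by (subst poly_eq_sum_coeff[OF assms], subst sum.swap) (simp add: sum_distrib_left)
  also have "[\<dots> = (\<Sum>i\<le>p-1. if i = p-1 then - coeff q i else 0)] (mod int p)"
  proof (rule cong_sum)
    fix i assume "i \<in> {..p-1}"
    then show "[coeff q i * (\<Sum>k\<in>Zp. k ^ i) = (if i = p-1 then - coeff q i else 0)] (mod int p)"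
      using power_sum_cong_0[of i] cong_scalar_left[OF power_sum_top, of "coeff q (p-1)"]
      by (cases "i = p-1") (auto simp: cong_0_iff)
  qed
  finally show ?thesis by simp
qed

section \<open>The quadratic character and its correlations\<close>

definition chi :: "int \<Rightarrow> int" where "chi k = Legendre k (int p)"

text \<open>The exponent of Euler's criterion: \<open>chi k\<close> is congruent to
  \<open>k ^ r\<close>, which turns character sums into sums of polynomial values.\<close>

definition r :: nat where "r = (p - 1) div 2"

lemma p_eq: "p = 2 * r + 1"
  using prime_odd_nat[OF prime_p] p_ge_5 unfolding r_def by (auto elim!: oddE)

lemma r_ge: "r \<ge> 2" using p_eq p_ge_5 by linarith

lemma chi_periodic: "periodic chi"
  unfolding periodic_def chi_def Legendre_def QuadRes_def by (auto simp: cong_def)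

lemma chi_cong: "[chi k = k ^ r] (mod int p)"
  unfolding chi_def r_def using euler_criterion[OF prime_p, of k] p_ge_5 by simp

lemma chi_cases: "chi k = 0 \<and> int p dvd k \<or> \<not> int p dvd k \<and> (chi k = 1 \<or> chi k = -1)"
  unfolding chi_def Legendre_def by (auto simp: cong_0_iff)

lemma abs_chi_le: "\<bar>chi k\<bar> \<le> 1"
  using chi_cases[of k] by auto

lemma chi_eq_0_iff: "chi k = 0 \<longleftrightarrow> int p dvd k"
  using chi_cases[of k] by auto

lemma dvd_abs_less_imp_0: "int p dvd x \<Longrightarrow> \<bar>x\<bar> < int p \<Longrightarrow> x = 0"
  using zdvd_not_zless[of "\<bar>x\<bar>" "int p"] by (cases "x = 0") auto

text \<open>Euler's criterion makes the sum divisible by \<open>p\<close>, and with at most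
  \<open>p - 1\<close> nonzero terms it is too small to be a nonzero multiple.\<close>

lemma sum_chi: "(\<Sum>k\<in>Zp. chi (k + t)) = 0"
proof -
  have "[(\<Sum>k\<in>Zp. chi k) = (\<Sum>k\<in>Zp. k ^ r)] (mod int p)"
    by (intro cong_sum chi_cong)
  moreover have "int p dvd (\<Sum>k\<in>Zp. k ^ r)" using power_sum_cong_0[of r] p_eq r_ge by simp
  ultimately have "int p dvd (\<Sum>k\<in>Zp. chi k)" by (simp add: cong_dvd_iff)
  moreover have "\<bar>\<Sum>k\<in>Zp. chi k\<bar> < int p"
  proof -
    have "(\<Sum>k\<in>Zp. chi k) = (\<Sum>k\<in>Zp - {0}. chi k)"
      by (rule sum.mono_neutral_right) (auto simp: chi_eq_0_iff)
    also have "\<bar>\<dots>\<bar> \<le> (\<Sum>k\<in>Zp-{0}. 1)"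
      by (rule order_trans[OF sum_abs]) (intro sum_mono abs_chi_le)
    also have "\<dots> = int p - 1" using p_ge_5 by simp
    finally show ?thesis by simp
  qed
  ultimately show ?thesis using sum_shift[OF chi_periodic] dvd_abs_less_imp_0 by simp
qed

lemma periodic_shift: "periodic f \<Longrightarrow> periodic (\<lambda>k. f (k + t))"
  unfolding periodic_def by (auto simp: cong_add_rcancel)

lemma periodic_mult: "periodic f \<Longrightarrow> periodic g \<Longrightarrow> periodic (\<lambda>k. f k * g k)"
  unfolding periodic_def by (intro allI impI arg_cong2[where f="(*)"]) simp_all

text \<open>For \<open>t\<close> not divisible by \<open>p\<close>, Euler's criterion replaces the
  summand by a monic polynomial of degree \<open>p - 1\<close>, which gives \<open>-1\<close> modulo
  \<open>p\<close>; a size estimate lifts this to an equality.\<close>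

lemma sum_chi_chi: "(\<Sum>k\<in>Zp. chi k * chi (k + t)) = (if int p dvd t then int p - 1 else -1)"
proof (cases "int p dvd t")
  case True
  have "(\<Sum>k\<in>Zp. chi k * chi (k + t)) = (\<Sum>k\<in>Zp. if k = 0 then 0 else 1)"
  proof (rule sum.cong)
    fix k assume "k \<in> Zp"
    then have "int p dvd k \<longleftrightarrow> k = 0" using zdvd_not_zless by (auto simp: less_le)
    moreover have "chi (k + t) = chi k"
      using True by (intro periodicD[OF chi_periodic]) (simp add: cong_iff_dvd_diff)
    ultimately show "chi k * chi (k + t) = (if k = 0 then 0 else 1)"
      using chi_cases[of k] by auto
  qed simp
  also have "\<dots> = (\<Sum>k\<in>Zp - {0}. 1)"
    by (rule sum.mono_neutral_cong_right) auto
  also have "\<dots> = int p - 1" using p_ge_5 by simp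
  finally show ?thesis using True by simp
next
  case False
  let ?q = "[:0,1:] ^ r * [:t,1:] ^ r :: int poly"
  have deg: "degree ?q = p - 1"
    using p_eq by (simp add: degree_mult_eq degree_power_eq)
  have "lead_coeff ?q = 1" by (simp add: lead_coeff_mult lead_coeff_power)
  then have "coeff ?q (p - 1) = 1" using deg by simp
  then have "[(\<Sum>k\<in>Zp. poly ?q k) = -1] (mod int p)" using sum_poly_cong[of ?q] deg by simp
  moreover have "[(\<Sum>k\<in>Zp. chi k * chi (k + t)) = (\<Sum>k\<in>Zp. poly ?q k)] (mod int p)"
    by (intro cong_sum) (use chi_cong in \<open>auto simp: poly_power add.commute intro!: cong_mult\<close>)
  ultimately have "[(\<Sum>k\<in>Zp. chi k * chi (k + t)) = -1] (mod int p)" using cong_trans by blast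
  then have d: "int p dvd (\<Sum>k\<in>Zp. chi k * chi (k + t)) + 1" by (simp add: cong_iff_dvd_diff)
  have "\<bar>\<Sum>k\<in>Zp. chi k * chi (k + t)\<bar> \<le> int p - 2"
  proof -
    \<comment> \<open>The second zero of the summand. Discarding both zeros leaves
      \<open>p - 2\<close> terms, so the sum plus one stays strictly below \<open>p\<close> in
      absolute value.\<close>
    let ?z = "(-t) mod int p"
    have z: "?z \<in> Zp" "?z \<noteq> 0" using False mod_in_Zp[of "-t"] by (auto simp only: dvd_eq_mod_eq_0[symmetric] dvd_minus_iff)
    have "int p dvd ?z + t" by (simp add: dvd_eq_mod_eq_0 mod_simps)
    then have "(\<Sum>k\<in>Zp. chi k * chi (k + t)) = (\<Sum>k\<in>Zp - {0, ?z}. chi k * chi (k + t))"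
      by (intro sum.mono_neutral_right) (auto simp: chi_eq_0_iff)
    also have "\<bar>\<dots>\<bar> \<le> (\<Sum>k\<in>Zp-{0,?z}. 1)"
      by (rule order_trans[OF sum_abs], intro sum_mono)
         (simp add: abs_mult mult_le_one abs_chi_le)
    also have "\<dots> = int p - 2" using p_ge_5 z by (simp add: card_Diff_subset)
    finally show ?thesis .
  qed
  then have "(\<Sum>k\<in>Zp. chi k * chi (k + t)) + 1 = 0"
    using d by (intro dvd_abs_less_imp_0) auto
  then show ?thesis using False by simp
qed

section \<open>Correlations and quadratic twists\<close>

definition corr :: "(int \<Rightarrow> int) \<Rightarrow> (int \<Rightarrow> int) \<Rightarrow> int \<Rightarrow> int" where
  "corr f g t = (\<Sum>k\<in>Zp. f k * g (k + t))"

text \<open>Away from frequency zero this multiplies Fourier coefficients by a quadratic Gauss sum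
  up to sign, so it is an integral substitute for working with such sums.\<close>

definition twist :: "(int \<Rightarrow> int) \<Rightarrow> int \<Rightarrow> int" where
  "twist c j = (\<Sum>k\<in>Zp. c k * chi (k - j))"

lemma sum_corr:
  assumes "periodic g"
  shows "(\<Sum>t\<in>Zp. corr f g t) = (\<Sum>k\<in>Zp. f k) * (\<Sum>k\<in>Zp. g k)"
proof -
  have "(\<Sum>t\<in>Zp. corr f g t) = (\<Sum>k\<in>Zp. f k * (\<Sum>t\<in>Zp. g (t + k)))"
    unfolding corr_def by (subst sum.swap) (simp add: sum_distrib_left add.commute)
  then show ?thesis by (simp add: sum_shift[OF assms] sum_distrib_right)
qed

text \<open>Powers of the summation variable are periodic only modulo \<open>p\<close>, so their
  sums are shifted by this version of \<open>sum_shift\<close>.\<close>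

lemma sum_shift_cong:
  assumes "\<And>x y. [x = y] (mod int p) \<Longrightarrow> [F x = F y] (mod int p)"
  shows "[(\<Sum>k\<in>Zp. F (k + t)) = (\<Sum>k\<in>Zp. F k)] (mod int p)"
proof -
  have "periodic (\<lambda>k. F k mod int p)"
    using assms unfolding periodic_def cong_def by blast
  from sum_shift[OF this, of t]
  have "(\<Sum>k\<in>Zp. F (k + t) mod int p) mod int p = (\<Sum>k\<in>Zp. F k mod int p) mod int p" by simp
  then show ?thesis by (simp only: cong_def mod_sum_eq)
qed

lemma sum_mult_power_diff:
  fixes S :: "int \<Rightarrow> int"
  shows "(\<Sum>l\<in>Zp. S l * (l - k) ^ n)
       = (\<Sum>i\<le>n. of_nat (n choose i) * (- k) ^ (n - i) * (\<Sum>l\<in>Zp. S l * l ^ i))"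
proof -
  have "S l * (l - k) ^ n = (\<Sum>i\<le>n. of_nat (n choose i) * (- k) ^ (n - i) * (S l * l ^ i))" for l
    using binomial_ring[of l "- k" n] by (simp add: sum_distrib_left mult_ac)
  then show ?thesis by (simp add: sum_distrib_left) (subst sum.swap, simp)
qed

text \<open>Compute the moment of order \<open>2 * n\<close> of the correlation in two ways. It
  vanishes modulo \<open>p\<close> because the correlation is constant there; expanded, it is a sum
  of products of moments of \<open>S\<close> whose orders add up to \<open>2 * n\<close>, and by
  induction only the square of the \<open>n\<close>-th moment survives.\<close>

lemma moment_vanishes:
  assumes S: "periodic S" and corr: "\<And>t. [corr S S t = -4] (mod int p)"
  shows "n < r \<Longrightarrow> int p dvd (\<Sum>k\<in>Zp. S k * k ^ n)"
proof (induction n rule: less_induct)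
  case (less n)
  define M where "M i = (\<Sum>k\<in>Zp. S k * k ^ i)" for i
  have IH: "int p dvd M i" if "i < n" for i using less that unfolding M_def by auto
  have "[(\<Sum>t\<in>Zp. corr S S t * t ^ (2*n)) = (\<Sum>t\<in>Zp. (-4) * t ^ (2*n))] (mod int p)"
    by (intro cong_sum cong_scalar_right corr)
  moreover have "int p dvd (\<Sum>t\<in>Zp. (-4) * t ^ (2*n))"
    unfolding sum_distrib_left[symmetric] using less.prems p_eq by (intro dvd_mult power_sum_cong_0) auto
  ultimately have 1: "int p dvd (\<Sum>t\<in>Zp. corr S S t * t ^ (2*n))" by (simp add: cong_dvd_iff)
  have "(\<Sum>t\<in>Zp. corr S S t * t ^ (2*n)) = (\<Sum>k\<in>Zp. S k * (\<Sum>t\<in>Zp. S (t + k) * ((t + k) - k) ^ (2*n)))"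
    unfolding corr_def sum_distrib_right
    by (subst sum.swap) (simp add: sum_distrib_left add.commute mult.assoc)
  also have "[\<dots> = (\<Sum>k\<in>Zp. S k * (\<Sum>l\<in>Zp. S l * (l - k) ^ (2*n)))] (mod int p)"
  proof (rule cong_sum, rule cong_scalar_left)
    fix k
    show "[(\<Sum>t\<in>Zp. S (t + k) * ((t + k) - k) ^ (2*n)) = (\<Sum>l\<in>Zp. S l * (l - k) ^ (2*n))] (mod int p)"
    proof (rule sum_shift_cong[where F="\<lambda>l. S l * (l - k) ^ (2*n)"])
      fix x y assume "[x = y] (mod int p)"
      then show "[S x * (x - k) ^ (2*n) = S y * (y - k) ^ (2*n)] (mod int p)"
        by (intro cong_mult cong_pow cong_diff cong_refl) (simp_all add: periodicD[OF S])
    qed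
  qed
  also have "(\<Sum>k\<in>Zp. S k * (\<Sum>l\<in>Zp. S l * (l - k) ^ (2*n)))
      = (\<Sum>i\<le>2*n. of_nat ((2*n) choose i) * (-1) ^ (2*n - i) * M i * M (2*n - i))"
  proof -
    have "S k * (\<Sum>i\<le>2*n. of_nat ((2*n) choose i) * (- k) ^ (2*n - i) * M i)
        = (\<Sum>i\<le>2*n. of_nat ((2*n) choose i) * (-1) ^ (2*n - i) * M i * (S k * k ^ (2*n - i)))" for k
      unfolding sum_distrib_left by (rule sum.cong[OF refl], subst power_minus, simp only: mult_ac)
    then have "(\<Sum>k\<in>Zp. S k * (\<Sum>l\<in>Zp. S l * (l - k) ^ (2*n)))
        = (\<Sum>k\<in>Zp. \<Sum>i\<le>2*n. of_nat ((2*n) choose i) * (-1) ^ (2*n - i) * M i * (S k * k ^ (2*n - i)))"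
      unfolding sum_mult_power_diff M_def[symmetric] by (simp only:)
    also have "\<dots> = (\<Sum>i\<le>2*n. of_nat ((2*n) choose i) * (-1) ^ (2*n - i) * M i * M (2*n - i))"
      by (subst sum.swap) (simp only: sum_distrib_left[symmetric] M_def)
    finally show ?thesis .
  qed
  finally have "int p dvd (\<Sum>i\<le>2*n. of_nat ((2*n) choose i) * (-1) ^ (2*n - i) * M i * M (2*n - i))"
    using 1 by (simp add: cong_dvd_iff)
  also have "(\<Sum>i\<le>2*n. of_nat ((2*n) choose i) * (-1) ^ (2*n - i) * M i * M (2*n - i))
    = of_nat ((2*n) choose n) * (-1) ^ n * M n * M n
      + (\<Sum>i\<in>{..2*n} - {n}. of_nat ((2*n) choose i) * (-1) ^ (2*n - i) * M i * M (2*n - i))"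
    by (subst sum.remove[of _ n]) auto
  finally have "int p dvd of_nat ((2*n) choose n) * (-1) ^ n * M n * M n
      + (\<Sum>i\<in>{..2*n} - {n}. of_nat ((2*n) choose i) * (-1) ^ (2*n - i) * M i * M (2*n - i))" .
  moreover have "int p dvd (\<Sum>i\<in>{..2*n} - {n}. of_nat ((2*n) choose i) * (-1) ^ (2*n - i) * M i * M (2*n - i))"
  proof (rule dvd_sum)
    fix i assume "i \<in> {..2*n} - {n}"
    then have "i < n \<or> 2*n - i < n" by auto
    then show "int p dvd of_nat ((2*n) choose i) * (-1) ^ (2*n - i) * M i * M (2*n - i)"
      using IH by (auto intro: dvd_mult dvd_mult2)
  qed
  ultimately have d: "int p dvd of_nat ((2*n) choose n) * (-1) ^ n * M n * M n"
    by (simp add: dvd_add_left_iff)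
  \<comment> \<open>As \<open>2 * n < p\<close>, the middle binomial coefficient is invertible
    modulo \<open>p\<close>.\<close>
  have "\<not> p dvd fact (2*n)"
    using less.prems p_eq prime_p by (subst prime_dvd_fact_iff) auto
  moreover have "(2*n) choose n dvd fact (2*n)"
    using binomial_fact_lemma[of n "2*n"] by (metis dvd_triv_right le_add1 mult_2)
  ultimately have "\<not> p dvd (2*n) choose n" by (meson dvd_trans)
  then have "\<not> int p dvd of_nat ((2*n) choose n)" by (simp only: int_dvd_int_iff not_False_eq_True)
  moreover have "\<not> int p dvd (-1) ^ n"
    using prime_int_p prime_dvd_power[of "int p" "-1" n] p_ge_5 by auto
  ultimately show ?case using d prime_int_p unfolding M_def[symmetric] by (auto simp: prime_dvd_mult_iff)
qed

text \<open>Expand \<open>(k - j) ^ r\<close>: the lower moments vanish, so modulo \<open>p\<close>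
  the twist no longer depends on \<open>j\<close>.\<close>

lemma twist_cong_moment:
  assumes S: "periodic S" and corr: "\<And>t. [corr S S t = -4] (mod int p)"
  shows "[twist S j = (\<Sum>k\<in>Zp. S k * k ^ r)] (mod int p)"
proof -
  have "[twist S j = (\<Sum>k\<in>Zp. S k * (k - j) ^ r)] (mod int p)"
    unfolding twist_def by (intro cong_sum cong_scalar_left chi_cong)
  also have "(\<Sum>k\<in>Zp. S k * (k - j) ^ r) = (\<Sum>i<r. of_nat (r choose i) * (- j) ^ (r - i) * (\<Sum>l\<in>Zp. S l * l ^ i))
     + (\<Sum>k\<in>Zp. S k * k ^ r)"
    by (simp add: sum_mult_power_diff lessThan_Suc_atMost[symmetric])
  also have "[\<dots> = 0 + (\<Sum>k\<in>Zp. S k * k ^ r)] (mod int p)"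
    by (intro cong_add cong_refl)
       (auto simp: cong_0_iff intro!: dvd_sum dvd_mult moment_vanishes[OF S corr])
  finally show ?thesis by simp
qed

lemma sum_chi_chi_shift:
  "(\<Sum>j\<in>Zp. chi (k - j) * chi (l - j)) = int p * of_bool ([l = k] (mod int p)) - 1"
proof -
  have "periodic (\<lambda>j. chi j * chi (j + (l - k)))"
    by (intro periodic_mult periodic_shift chi_periodic)
  from sum_reflect[OF this, of k]
  have "(\<Sum>j\<in>Zp. chi (k - j) * chi (l - j)) = (\<Sum>j\<in>Zp. chi j * chi (j + (l - k)))"
    by (simp add: algebra_simps)
  then show ?thesis by (simp add: sum_chi_chi cong_iff_dvd_diff)
qed

lemma periodic_twist: "periodic (twist c)"
  unfolding periodic_def twist_def
  by (auto intro!: sum.cong arg_cong2[where f="(*)"] periodicD[OF chi_periodic] cong_diff)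

lemma sum_twist: "(\<Sum>j\<in>Zp. twist c j) = 0"
proof -
  have "(\<Sum>j\<in>Zp. chi (k - j)) = 0" for k
    using sum_reflect[OF chi_periodic, of k] sum_chi[of 0] by simp
  then show ?thesis unfolding twist_def
    by (subst sum.swap) (simp add: sum_distrib_left[symmetric])
qed

text \<open>Orthogonality of the shifts of \<open>chi\<close> inverts the twist, up to the factor
  \<open>p\<close> and the total of \<open>c\<close>.\<close>

lemma untwist:
  assumes "periodic c"
  shows "(\<Sum>j\<in>Zp. twist c j * chi (k - j)) = int p * c k - (\<Sum>l\<in>Zp. c l)"
proof -
  have "(\<Sum>j\<in>Zp. twist c j * chi (k - j)) = (\<Sum>l\<in>Zp. c l * (\<Sum>j\<in>Zp. chi (k - j) * chi (l - j)))"
    unfolding twist_def sum_distrib_left sum_distrib_right by (subst sum.swap) (simp add: mult_ac)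
  also have "\<dots> = int p * (\<Sum>l\<in>Zp. c l * of_bool ([l = k] (mod int p))) - (\<Sum>l\<in>Zp. c l)"
    unfolding sum_chi_chi_shift
    by (simp add: right_diff_distrib sum_subtractf sum_distrib_left mult.left_commute del: sum_mult_of_bool_eq)
  finally show ?thesis by (simp only: sum_Zp_delta[OF assms])
qed

text \<open>A Parseval identity: twisting scales correlations by \<open>p\<close>, apart from the
  frequency-zero part, which is subtracted.\<close>

lemma corr_twist:
  assumes c: "periodic c" and d: "periodic d"
  shows "corr (twist c) (twist d) t = int p * corr c d t - (\<Sum>k\<in>Zp. c k) * (\<Sum>k\<in>Zp. d k)"
proof -
  have "corr (twist c) (twist d) t = (\<Sum>l\<in>Zp. d l * (\<Sum>j\<in>Zp. twist c j * chi ((l - t) - j)))"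
    unfolding corr_def twist_def[of d] sum_distrib_left by (subst sum.swap) (simp add: algebra_simps)
  also have "\<dots> = int p * (\<Sum>l\<in>Zp. d l * c (l - t)) - (\<Sum>k\<in>Zp. c k) * (\<Sum>k\<in>Zp. d k)"
    unfolding untwist[OF c]
    by (simp add: right_diff_distrib sum_subtractf sum_distrib_left sum_distrib_right mult_ac)
  also have "(\<Sum>l\<in>Zp. d l * c (l - t)) = corr c d t"
    using sum_shift[OF periodic_mult[OF d periodic_shift[OF c, of "-t"]], of t]
    by (simp add: corr_def mult.commute)
  finally show ?thesis .
qed

text \<open>Carries correlations over from twists to their quotients by \<open>p\<close>; the
  vanishing totals remove the mixed terms.\<close>

lemma corr_affine:
  assumes "periodic V" "periodic W" "\<And>j. V j = m + int p * T j" "\<And>j. W j = n + int p * U j"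
    and "(\<Sum>j\<in>Zp. V j) = 0" "(\<Sum>j\<in>Zp. W j) = 0"
  shows "int p ^ 2 * corr T U t = corr V W t + int p * m * n"
proof -
  have "int p ^ 2 * corr T U t = (\<Sum>j\<in>Zp. (V j - m) * (W (j + t) - n))"
    unfolding corr_def assms(3,4) by (simp add: sum_distrib_left power2_eq_square mult_ac)
  also have "\<dots> = corr V W t - n * (\<Sum>j\<in>Zp. V j) - m * (\<Sum>j\<in>Zp. W (j + t)) + int p * m * n"
    unfolding corr_def by (simp add: algebra_simps sum.distrib sum_subtractf sum_distrib_left)
  finally show ?thesis by (simp add: sum_shift assms(2,5,6))
qed

text \<open>The twist is a constant \<open>\<mu>\<close> modulo \<open>p\<close>, and the integral
  correlation of the quotients at a nonzero shift makes \<open>\<mu> * \<mu> - 4\<close> a multiple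
  of \<open>p\<close>. The parameter \<open>q\<close> covers the trivial character of the Klein
  group (\<open>q = 16\<close>) together with the others (\<open>q = 0\<close>).\<close>

lemma twist_cong_pm_2:
  assumes S: "periodic S" and corr: "\<And>t. corr S S t = 4 * int p * of_bool (int p dvd t) + q * int p - 4"
  obtains e where "e = 1 \<or> e = -1" "\<And>j. [twist S j = 2 * e] (mod int p)"
proof -
  define \<mu> where "\<mu> = (\<Sum>k\<in>Zp. S k * k ^ r)"
  have c4: "[corr S S t = -4] (mod int p)" for t
    by (simp add: corr cong_iff_dvd_diff)
  have \<mu>: "[twist S j = \<mu>] (mod int p)" for j
    unfolding \<mu>_def by (rule twist_cong_moment[OF S c4])
  define T where "T j = (twist S j - \<mu>) div int p" for j
  have T: "twist S j = \<mu> + int p * T j" for j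
    using \<mu>[of j] by (simp add: T_def cong_iff_dvd_diff)
  \<comment> \<open>Summing the correlation over all shifts determines the square of the total of
    \<open>S\<close>.\<close>
  have "(\<Sum>t\<in>Zp. corr S S t) = 4 * int p * (\<Sum>t\<in>Zp. 1 * of_bool ([t = 0] (mod int p))) + int p * (q * int p - 4)"
    unfolding corr by (simp add: sum.distrib sum_subtractf sum_distrib_left cong_0_iff right_diff_distrib)
  also have "(\<Sum>t\<in>Zp. 1 * of_bool ([t = 0] (mod int p))) = (1::int)"
    by (subst sum_Zp_delta) (auto simp: periodic_def)
  finally have q: "(\<Sum>k\<in>Zp. S k) * (\<Sum>k\<in>Zp. S k) = q * int p * int p"
    unfolding sum_corr[OF S] by (simp add: algebra_simps)
  \<comment> \<open>The shift \<open>1\<close> stands for any nonzero shift: the two contributions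
    of \<open>q\<close> cancel and \<open>-4 * int p\<close> remains.\<close>
  have "\<not> int p dvd 1" using p_ge_5 by simp
  then have "corr (twist S) (twist S) 1 = - 4 * int p"
    unfolding corr_twist[OF S S] q corr by (simp add: algebra_simps)
  with corr_affine[OF periodic_twist periodic_twist T T sum_twist sum_twist, of 1]
  have "int p * (int p * corr T T 1) = int p * (\<mu> * \<mu> - 4)" by (simp add: algebra_simps power2_eq_square)
  then have "int p * corr T T 1 = \<mu> * \<mu> - 4"
    by (subst (asm) mult_cancel_left) (use p_ge_5 in auto)
  then have "int p * corr T T 1 = (\<mu> - 2) * (\<mu> + 2)" by (simp add: algebra_simps)
  then have "int p dvd (\<mu> - 2) * (\<mu> + 2)" by (metis dvd_triv_left)
  then consider "int p dvd \<mu> - 2" | "int p dvd \<mu> + 2" using prime_int_p prime_dvd_mult_iff by blast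
  then show ?thesis
  proof cases
    case 1
    then have "[\<mu> = 2 * 1] (mod int p)" by (simp add: cong_iff_dvd_diff)
    then show ?thesis using that[of 1] \<mu> cong_trans by blast
  next
    case 2
    then have "[\<mu> = 2 * -1] (mod int p)" by (simp add: cong_iff_dvd_diff)
    then show ?thesis using that[of "-1"] \<mu> cong_trans by blast
  qed
qed

text \<open>The four character sums of the \<open>c\<close>s are twists congruent to \<open>\<plusminus>2\<close>. Their inverse transform over
  the Klein group is a half-sum of four signs, hence integral, and this is the residue \<open>m\<close> that makes
  \<open>twist c - m\<close> divisible by \<open>p\<close>.\<close>

lemma twist_integral_quotients:
  fixes c0 c1 c2 c3 :: "int \<Rightarrow> int"
  assumes per: "periodic c0" "periodic c1" "periodic c2" "periodic c3"
    and sum: "(\<Sum>k\<in>Zp. c0 k) = int p" "(\<Sum>k\<in>Zp. c1 k) = int p"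
             "(\<Sum>k\<in>Zp. c2 k) = int p" "(\<Sum>k\<in>Zp. c3 k) = int p"
    and A0: "\<And>t. corr c0 c0 t + corr c1 c1 t + corr c2 c2 t + corr c3 c3 t
                  = 4 * (int p - 1) + 4 * int p * of_bool (int p dvd t)"
    and A1: "\<And>t. corr c0 c1 t + corr c1 c0 t + corr c2 c3 t + corr c3 c2 t = 4 * int p"
    and A2: "\<And>t. corr c0 c2 t + corr c2 c0 t + corr c1 c3 t + corr c3 c1 t = 4 * int p"
    and A3: "\<And>t. corr c0 c3 t + corr c3 c0 t + corr c1 c2 t + corr c2 c1 t = 4 * int p"
  obtains U0 U1 U2 U3 :: "int \<Rightarrow> int" where
    "periodic U0" "periodic U1" "periodic U2" "periodic U3"
    "\<And>k. c0 k = 1 + (\<Sum>j\<in>Zp. U0 j * chi (k - j))"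
    "\<And>k. c1 k = 1 + (\<Sum>j\<in>Zp. U1 j * chi (k - j))"
    "\<And>k. c2 k = 1 + (\<Sum>j\<in>Zp. U2 j * chi (k - j))"
    "\<And>k. c3 k = 1 + (\<Sum>j\<in>Zp. U3 j * chi (k - j))"
    "\<And>t. corr U0 U0 t + corr U1 U1 t + corr U2 U2 t + corr U3 U3 t = 4 * of_bool (int p dvd t)"
    "\<And>t. corr U0 U1 t + corr U1 U0 t + corr U2 U3 t + corr U3 U2 t = 0"
    "\<And>t. corr U0 U2 t + corr U2 U0 t + corr U1 U3 t + corr U3 U1 t = 0"
    "\<And>t. corr U0 U3 t + corr U3 U0 t + corr U1 U2 t + corr U2 U1 t = 0"
proof -
  \<comment> \<open>The transforms of the \<open>c\<close>s under the four characters of the Klein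
    group.\<close>
  define S1 where "S1 k = c0 k + c1 k + c2 k + c3 k" for k
  define S2 where "S2 k = c0 k + c1 k - c2 k - c3 k" for k
  define S3 where "S3 k = c0 k - c1 k + c2 k - c3 k" for k
  define S4 where "S4 k = c0 k - c1 k - c2 k + c3 k" for k
  note S_defs = S1_def S2_def S3_def S4_def
  have perS: "periodic S1" "periodic S2" "periodic S3" "periodic S4"
    unfolding periodic_def S_defs by (metis per periodicD)+
  note A = A0 A1 A2 A3
  have corrS1: "corr S1 S1 t = 4 * int p * of_bool (int p dvd t) + 16 * int p - 4" for t
  proof -
    have "corr S1 S1 t = (corr c0 c0 t + corr c1 c1 t + corr c2 c2 t + corr c3 c3 t)
      + (corr c0 c1 t + corr c1 c0 t + corr c2 c3 t + corr c3 c2 t)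
      + (corr c0 c2 t + corr c2 c0 t + corr c1 c3 t + corr c3 c1 t)
      + (corr c0 c3 t + corr c3 c0 t + corr c1 c2 t + corr c2 c1 t)"
      by (simp add: corr_def S_defs algebra_simps sum.distrib sum_subtractf)
    then show ?thesis unfolding A by simp
  qed
  have corrS2: "corr S2 S2 t = 4 * int p * of_bool (int p dvd t) + 0 * int p - 4" for t
  proof -
    have "corr S2 S2 t = (corr c0 c0 t + corr c1 c1 t + corr c2 c2 t + corr c3 c3 t)
      + (corr c0 c1 t + corr c1 c0 t + corr c2 c3 t + corr c3 c2 t)
      - (corr c0 c2 t + corr c2 c0 t + corr c1 c3 t + corr c3 c1 t)
      - (corr c0 c3 t + corr c3 c0 t + corr c1 c2 t + corr c2 c1 t)"
      by (simp add: corr_def S_defs algebra_simps sum.distrib sum_subtractf)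
    then show ?thesis unfolding A by simp
  qed
  have corrS3: "corr S3 S3 t = 4 * int p * of_bool (int p dvd t) + 0 * int p - 4" for t
  proof -
    have "corr S3 S3 t = (corr c0 c0 t + corr c1 c1 t + corr c2 c2 t + corr c3 c3 t)
      - (corr c0 c1 t + corr c1 c0 t + corr c2 c3 t + corr c3 c2 t)
      + (corr c0 c2 t + corr c2 c0 t + corr c1 c3 t + corr c3 c1 t)
      - (corr c0 c3 t + corr c3 c0 t + corr c1 c2 t + corr c2 c1 t)"
      by (simp add: corr_def S_defs algebra_simps sum.distrib sum_subtractf)
    then show ?thesis unfolding A by simp
  qed
  have corrS4: "corr S4 S4 t = 4 * int p * of_bool (int p dvd t) + 0 * int p - 4" for t
  proof -
    have "corr S4 S4 t = (corr c0 c0 t + corr c1 c1 t + corr c2 c2 t + corr c3 c3 t)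
      - (corr c0 c1 t + corr c1 c0 t + corr c2 c3 t + corr c3 c2 t)
      - (corr c0 c2 t + corr c2 c0 t + corr c1 c3 t + corr c3 c1 t)
      + (corr c0 c3 t + corr c3 c0 t + corr c1 c2 t + corr c2 c1 t)"
      by (simp add: corr_def S_defs algebra_simps sum.distrib sum_subtractf)
    then show ?thesis unfolding A by simp
  qed
  obtain e1 where e1: "e1 = 1 \<or> e1 = -1" "\<And>j. [twist S1 j = 2 * e1] (mod int p)"
    using twist_cong_pm_2[OF perS(1) corrS1] by blast
  obtain e2 where e2: "e2 = 1 \<or> e2 = -1" "\<And>j. [twist S2 j = 2 * e2] (mod int p)"
    using twist_cong_pm_2[OF perS(2) corrS2] by blast
  obtain e3 where e3: "e3 = 1 \<or> e3 = -1" "\<And>j. [twist S3 j = 2 * e3] (mod int p)"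
    using twist_cong_pm_2[OF perS(3) corrS3] by blast
  obtain e4 where e4: "e4 = 1 \<or> e4 = -1" "\<And>j. [twist S4 j = 2 * e4] (mod int p)"
    using twist_cong_pm_2[OF perS(4) corrS4] by blast
  define m0 where "m0 = (e1 + e2 + e3 + e4) div 2"
  define m1 where "m1 = (e1 + e2 - e3 - e4) div 2"
  define m2 where "m2 = (e1 - e2 + e3 - e4) div 2"
  define m3 where "m3 = (e1 - e2 - e3 + e4) div 2"
  have m: "2 * m0 = e1 + e2 + e3 + e4" "2 * m1 = e1 + e2 - e3 - e4"
      "2 * m2 = e1 - e2 + e3 - e4" "2 * m3 = e1 - e2 - e3 + e4"
    using e1(1) e2(1) e3(1) e4(1) unfolding m0_def m1_def m2_def m3_def by auto
  \<comment> \<open>All character values of the vector of the \<open>m\<close>s are \<open>2\<close>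
    or \<open>-2\<close>, so by orthogonality its autocorrelation on the Klein group is
    \<open>4\<close> at the identity and zero elsewhere.\<close>
  have mm: "m0 * m0 + m1 * m1 + m2 * m2 + m3 * m3 = 4" "m0 * m1 + m2 * m3 = 0"
      "m0 * m2 + m1 * m3 = 0" "m0 * m3 + m1 * m2 = 0"
    using e1(1) e2(1) e3(1) e4(1) unfolding m0_def m1_def m2_def m3_def by auto
  have d4: "int p dvd x" if "int p dvd 4 * x" for x
  proof -
    have "\<not> int p dvd 4" using not_dvd_small[of 4] p_ge_5 by simp
    then show ?thesis using that prime_int_p prime_dvd_mult_iff by blast
  qed
  have tw: "twist S1 j = twist c0 j + twist c1 j + twist c2 j + twist c3 j"
    "twist S2 j = twist c0 j + twist c1 j - twist c2 j - twist c3 j"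
    "twist S3 j = twist c0 j - twist c1 j + twist c2 j - twist c3 j"
    "twist S4 j = twist c0 j - twist c1 j - twist c2 j + twist c3 j" for j
    by (simp_all add: twist_def S_defs algebra_simps sum.distrib sum_subtractf)
  have E: "int p dvd twist S1 j - 2 * e1" "int p dvd twist S2 j - 2 * e2"
          "int p dvd twist S3 j - 2 * e3" "int p dvd twist S4 j - 2 * e4" for j
    using e1(2) e2(2) e3(2) e4(2) by (simp_all add: cong_iff_dvd_diff)
  have D0: "int p dvd twist c0 j - m0" for j
  proof (rule d4)
    have "4 * (twist c0 j - m0) = (twist S1 j - 2 * e1) + (twist S2 j - 2 * e2) + (twist S3 j - 2 * e3) + (twist S4 j - 2 * e4)"
      using m by (simp add: tw)
    then show "int p dvd 4 * (twist c0 j - m0)" by (simp only:) (intro dvd_add dvd_diff E)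
  qed
  have D1: "int p dvd twist c1 j - m1" for j
  proof (rule d4)
    have "4 * (twist c1 j - m1) = (twist S1 j - 2 * e1) + (twist S2 j - 2 * e2) - (twist S3 j - 2 * e3) - (twist S4 j - 2 * e4)"
      using m by (simp add: tw)
    then show "int p dvd 4 * (twist c1 j - m1)" by (simp only:) (intro dvd_add dvd_diff E)
  qed
  have D2: "int p dvd twist c2 j - m2" for j
  proof (rule d4)
    have "4 * (twist c2 j - m2) = (twist S1 j - 2 * e1) - (twist S2 j - 2 * e2) + (twist S3 j - 2 * e3) - (twist S4 j - 2 * e4)"
      using m by (simp add: tw)
    then show "int p dvd 4 * (twist c2 j - m2)" by (simp only:) (intro dvd_add dvd_diff E)
  qed
  have D3: "int p dvd twist c3 j - m3" for j
  proof (rule d4)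
    have "4 * (twist c3 j - m3) = (twist S1 j - 2 * e1) - (twist S2 j - 2 * e2) - (twist S3 j - 2 * e3) + (twist S4 j - 2 * e4)"
      using m by (simp add: tw)
    then show "int p dvd 4 * (twist c3 j - m3)" by (simp only:) (intro dvd_add dvd_diff E)
  qed
  define U where "U c m j = (twist c j - m) div int p" for c m j
  have U: "twist c j = m + int p * U c m j" if "\<And>j. int p dvd twist c j - m" for c m j
    using that[of j] by (simp add: U_def)
  note U = U[OF D0] U[OF D1] U[OF D2] U[OF D3]
  have perU: "periodic (U c m)" for c m
    unfolding U_def periodic_def using periodicD[OF periodic_twist[of c]] by metis
  have rep: "c k = 1 + (\<Sum>j\<in>Zp. U c m j * chi (k - j))"
    if "periodic c" "(\<Sum>k\<in>Zp. c k) = int p" "\<And>j. twist c j = m + int p * U c m j" for c m k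
  proof -
    have "int p * (\<Sum>j\<in>Zp. U c m j * chi (k - j)) = (\<Sum>j\<in>Zp. (twist c j - m) * chi (k - j))"
      using that(3) by (simp add: sum_distrib_left mult.assoc)
    also have "\<dots> = (int p * c k - int p) - m * (\<Sum>j\<in>Zp. chi (k - j))"
      unfolding left_diff_distrib sum_subtractf untwist[OF that(1)] that(2) by (simp add: sum_distrib_left)
    also have "(\<Sum>j\<in>Zp. chi (k - j)) = 0"
      using sum_reflect[OF chi_periodic, of k] sum_chi[of 0] by simp
    finally have "int p * (\<Sum>j\<in>Zp. U c m j * chi (k - j)) = int p * (c k - 1)"
      by (simp add: algebra_simps)
    then show ?thesis by (subst (asm) mult_cancel_left) (use p_ge_5 in auto)
  qed
  have cU: "int p ^ 2 * corr (U c m) (U d n) t = int p * corr c d t - int p * int p + int p * m * n"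
    if "periodic c" "periodic d" "(\<Sum>k\<in>Zp. c k) = int p" "(\<Sum>k\<in>Zp. d k) = int p"
      "\<And>j. twist c j = m + int p * U c m j" "\<And>j. twist d j = n + int p * U d n j" for c d m n t
    using corr_affine[OF periodic_twist periodic_twist that(5,6) sum_twist sum_twist, of t]
      corr_twist[OF that(1,2), of t] that(3,4) by simp
  have p2: "x = y" if "int p ^ 2 * x = int p ^ 2 * y" for x y :: int
    using that p_ge_5 by auto
  note cUs = cU[OF per(1) per(1) sum(1) sum(1) U(1) U(1)] cU[OF per(2) per(2) sum(2) sum(2) U(2) U(2)]
    cU[OF per(3) per(3) sum(3) sum(3) U(3) U(3)] cU[OF per(4) per(4) sum(4) sum(4) U(4) U(4)]
    cU[OF per(1) per(2) sum(1) sum(2) U(1) U(2)] cU[OF per(2) per(1) sum(2) sum(1) U(2) U(1)]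
    cU[OF per(1) per(3) sum(1) sum(3) U(1) U(3)] cU[OF per(3) per(1) sum(3) sum(1) U(3) U(1)]
    cU[OF per(1) per(4) sum(1) sum(4) U(1) U(4)] cU[OF per(4) per(1) sum(4) sum(1) U(4) U(1)]
    cU[OF per(2) per(3) sum(2) sum(3) U(2) U(3)] cU[OF per(3) per(2) sum(3) sum(2) U(3) U(2)]
    cU[OF per(2) per(4) sum(2) sum(4) U(2) U(4)] cU[OF per(4) per(2) sum(4) sum(2) U(4) U(2)]
    cU[OF per(3) per(4) sum(3) sum(4) U(3) U(4)] cU[OF per(4) per(3) sum(4) sum(3) U(4) U(3)]
  show ?thesis
  proof (rule that[OF perU[of c0 m0] perU[of c1 m1] perU[of c2 m2] perU[of c3 m3]
      rep[OF per(1) sum(1) U(1)] rep[OF per(2) sum(2) U(2)] rep[OF per(3) sum(3) U(3)] rep[OF per(4) sum(4) U(4)]])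
    fix t
    have "int p ^ 2 * (corr (U c0 m0) (U c0 m0) t + corr (U c1 m1) (U c1 m1) t
          + corr (U c2 m2) (U c2 m2) t + corr (U c3 m3) (U c3 m3) t)
        = int p * (corr c0 c0 t + corr c1 c1 t + corr c2 c2 t + corr c3 c3 t) - 4 * int p * int p
          + int p * (m0 * m0 + m1 * m1 + m2 * m2 + m3 * m3)"
      unfolding distrib_left cUs by (simp add: mult.assoc)
    \<comment> \<open>The \<open>4\<close> from \<open>mm\<close> cancels against the
      \<open>-1\<close> in \<open>4 * (int p - 1)\<close>, leaving only the delta.\<close>
    also have "\<dots> = int p ^ 2 * (4 * of_bool (int p dvd t))"
      unfolding A mm by (simp add: algebra_simps power2_eq_square)
    finally show "corr (U c0 m0) (U c0 m0) t + corr (U c1 m1) (U c1 m1) t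
          + corr (U c2 m2) (U c2 m2) t + corr (U c3 m3) (U c3 m3) t = 4 * of_bool (int p dvd t)"
      by (rule p2)
  next
    fix t
    have "int p ^ 2 * (corr (U c0 m0) (U c1 m1) t + corr (U c1 m1) (U c0 m0) t
          + corr (U c2 m2) (U c3 m3) t + corr (U c3 m3) (U c2 m2) t)
        = int p * (corr c0 c1 t + corr c1 c0 t + corr c2 c3 t + corr c3 c2 t) - 4 * int p * int p
          + 2 * int p * (m0 * m1 + m2 * m3)"
      unfolding distrib_left cUs by (simp add: mult_ac)
    also have "\<dots> = int p ^ 2 * 0"
      unfolding A mm by simp
    finally show "corr (U c0 m0) (U c1 m1) t + corr (U c1 m1) (U c0 m0) t
          + corr (U c2 m2) (U c3 m3) t + corr (U c3 m3) (U c2 m2) t = 0"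
      by (rule p2)
  next
    fix t
    have "int p ^ 2 * (corr (U c0 m0) (U c2 m2) t + corr (U c2 m2) (U c0 m0) t
          + corr (U c1 m1) (U c3 m3) t + corr (U c3 m3) (U c1 m1) t)
        = int p * (corr c0 c2 t + corr c2 c0 t + corr c1 c3 t + corr c3 c1 t) - 4 * int p * int p
          + 2 * int p * (m0 * m2 + m1 * m3)"
      unfolding distrib_left cUs by (simp add: mult_ac)
    also have "\<dots> = int p ^ 2 * 0"
      unfolding A mm by simp
    finally show "corr (U c0 m0) (U c2 m2) t + corr (U c2 m2) (U c0 m0) t
          + corr (U c1 m1) (U c3 m3) t + corr (U c3 m3) (U c1 m1) t = 0"
      by (rule p2)
  next
    fix t
    have "int p ^ 2 * (corr (U c0 m0) (U c3 m3) t + corr (U c3 m3) (U c0 m0) t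
          + corr (U c1 m1) (U c2 m2) t + corr (U c2 m2) (U c1 m1) t)
        = int p * (corr c0 c3 t + corr c3 c0 t + corr c1 c2 t + corr c2 c1 t) - 4 * int p * int p
          + 2 * int p * (m0 * m3 + m1 * m2)"
      unfolding distrib_left cUs by (simp add: mult_ac)
    also have "\<dots> = int p ^ 2 * 0"
      unfolding A mm by simp
    finally show "corr (U c0 m0) (U c3 m3) t + corr (U c3 m3) (U c0 m0) t
          + corr (U c1 m1) (U c2 m2) t + corr (U c2 m2) (U c1 m1) t = 0"
      by (rule p2)
  qed
qed

section \<open>Transforms bounded below\<close>

lemma sum_chi_chi_shift': "(\<Sum>k\<in>Zp. chi (k - i) * chi (k - j)) = int p * of_bool ([i = j] (mod int p)) - 1"
proof -
  have "periodic (\<lambda>k. chi k * chi (k + (i - j)))"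
    by (intro periodic_mult periodic_shift chi_periodic)
  from sum_shift[OF this, of "- i"] show ?thesis
    by (simp add: sum_chi_chi cong_iff_dvd_diff)
qed

text \<open>Each \<open>v k\<close> is at most the total \<open>a\<close>, because the other values
  are positive.\<close>

lemma sum_mult_Suc_le:
  fixes v :: "int \<Rightarrow> int"
  assumes "finite P" "\<And>k. k \<in> P \<Longrightarrow> v k \<ge> 1" "(\<Sum>k\<in>P. v k) = a"
  shows "(\<Sum>k\<in>P. v k * (v k + 1)) \<le> a * (a + 1)"
proof -
  have "(\<Sum>k\<in>P. v k * (v k + 1)) \<le> (\<Sum>k\<in>P. v k * (a + 1))"
  proof (rule sum_mono)
    fix k assume k: "k \<in> P"
    have "v k \<le> (\<Sum>k\<in>P. v k)"
      using k assms(1,2) by (intro member_le_sum) force+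
    then show "v k * (v k + 1) \<le> v k * (a + 1)"
      using assms(2)[OF k] assms(3) by (intro mult_left_mono) auto
  qed
  then show ?thesis using assms(3) by (simp add: sum_distrib_right[symmetric])
qed

text \<open>Here \<open>v\<close> plays the role of \<open>c - 1\<close> for a value count
  \<open>c\<close>, while \<open>m\<close> and \<open>n\<close> are the total and the weight (square
  sum) of \<open>U\<close>. Nonnegativity of \<open>c\<close> becomes a restriction on the integers
  \<open>m\<close> and \<open>n\<close>.\<close>

context
  fixes U v :: "int \<Rightarrow> int" and m n :: int
  defines "v \<equiv> \<lambda>k. \<Sum>j\<in>Zp. U j * chi (k - j)"
    and "m \<equiv> \<Sum>j\<in>Zp. U j" and "n \<equiv> \<Sum>j\<in>Zp. U j * U j"
begin

lemma sum_chi_transform: "(\<Sum>k\<in>Zp. v k) = 0"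
  unfolding v_def using sum_chi[of "- j" for j]
  by (subst sum.swap) (simp add: sum_distrib_left[symmetric])

lemma sum_sq_chi_transform: "(\<Sum>k\<in>Zp. v k * v k) = int p * n - m * m"
proof -
  have "(\<Sum>k\<in>Zp. v k * v k) = (\<Sum>k\<in>Zp. \<Sum>i\<in>Zp. \<Sum>j\<in>Zp. U i * U j * (chi (k - i) * chi (k - j)))"
    unfolding v_def sum_product by (simp add: mult_ac)
  also have "\<dots> = (\<Sum>i\<in>Zp. \<Sum>k\<in>Zp. \<Sum>j\<in>Zp. U i * U j * (chi (k - i) * chi (k - j)))"
    by (rule sum.swap)
  also have "\<dots> = (\<Sum>i\<in>Zp. \<Sum>j\<in>Zp. \<Sum>k\<in>Zp. U i * U j * (chi (k - i) * chi (k - j)))"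
    by (rule sum.cong[OF refl], rule sum.swap)
  also have "\<dots> = (\<Sum>i\<in>Zp. \<Sum>j\<in>Zp. U i * U j * (int p * of_bool (i = j) - 1))"
    unfolding sum_distrib_left[symmetric] sum_chi_chi_shift'
    by (intro sum.cong refl) (use Zp_cong_eq in \<open>auto\<close>)
  also have "\<dots> = (\<Sum>i\<in>Zp. int p * (U i * U i) - U i * m)"
  proof (rule sum.cong[OF refl])
    fix i assume i: "i \<in> Zp"
    have "(\<Sum>j\<in>Zp. U i * U j * (int p * of_bool (i = j) - 1))
        = (\<Sum>j\<in>Zp. (if i = j then int p * (U i * U j) else 0)) - U i * m"
      unfolding m_def sum_distrib_left sum_subtractf[symmetric]
      by (rule sum.cong) (auto simp: algebra_simps)
    then show "(\<Sum>j\<in>Zp. U i * U j * (int p * of_bool (i = j) - 1)) = int p * (U i * U i) - U i * m"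
      using i by simp
  qed
  finally show ?thesis 
    by (simp only: n_def m_def sum_subtractf sum_distrib_left[symmetric] sum_distrib_right[symmetric])
qed

text \<open>\<open>chi\<close> is odd except at multiples of \<open>p\<close>, so modulo
  \<open>2\<close> the value at \<open>k\<close> is the total of \<open>U\<close> without
  \<open>U k\<close>.\<close>

lemma even_chi_transform:
  assumes k: "k \<in> Zp"
  shows "even (v k + U k + m)"
proof -
  have "v k + U k + m = (\<Sum>j\<in>Zp. U j * chi (k - j) + (if j = k then U j else 0) + U j)"
    unfolding v_def m_def using k by (simp add: sum.distrib)
  also have "even \<dots>"
  proof (rule dvd_sum)
    fix j assume j: "j \<in> Zp"
    have "int p dvd k - j \<longleftrightarrow> j = k"
      using Zp_cong_eq[OF k j] by (auto simp: cong_iff_dvd_diff)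
    then show "even (U j * chi (k - j) + (if j = k then U j else 0) + U j)"
      using chi_cases[of "k - j"] by auto
  qed
  finally show ?thesis .
qed

text \<open>The values \<open>-1\<close> of \<open>v\<close> occur only where \<open>U\<close> is odd, so there are at most \<open>n\<close> of
  them; as \<open>v\<close> sums to zero, its positive part is too small for the sum of squares.\<close>

lemma chi_transform_bounded_below:
  assumes ge: "\<And>k. k \<in> Zp \<Longrightarrow> v k \<ge> -1" and "even m"
  obtains P a where "P \<subseteq> Zp" "0 \<le> a" "a \<le> n" "\<And>k. k \<in> P \<Longrightarrow> v k \<ge> 1"
    "(\<Sum>k\<in>P. v k) = a" "(\<Sum>k\<in>P. v k * (v k + 1)) = int p * n - m * m"
proof
  define P where "P = {k\<in>Zp. v k \<ge> 1}"
  \<comment> \<open>\<open>A\<close> collects the minimal values of \<open>v\<close>. Its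
    cardinality is the witness for \<open>a\<close>: since \<open>v\<close> sums to zero, the
    positive values add up to exactly that.\<close>
  define A where "A = {k\<in>Zp. v k = -1}"
  show "P \<subseteq> Zp" "\<And>k. k \<in> P \<Longrightarrow> v k \<ge> 1" by (auto simp: P_def)
  have "P \<subseteq> Zp" "A \<subseteq> Zp" by (auto simp: P_def A_def)
  then have fin: "finite P" "finite A" using finite_subset by blast+
  show "(0::int) \<le> int (card A)" by simp
  have "int (card A) = (\<Sum>k\<in>A. 1)" by simp
  also have "\<dots> \<le> (\<Sum>k\<in>A. U k * U k)"
  proof (rule sum_mono)
    fix k assume "k \<in> A"
    then have "odd (U k)" using even_chi_transform[of k] \<open>even m\<close> by (auto simp: A_def)
    then have "U k \<noteq> 0" by auto
    then show "1 \<le> U k * U k" by (auto simp: int_one_le_iff_zero_less zero_less_mult_iff)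
  qed
  also have "\<dots> \<le> n" unfolding n_def
    by (rule sum_mono2) (auto simp: A_def)
  finally show "int (card A) \<le> n" .
  have "0 = (\<Sum>k\<in>Zp. v k)" by (simp add: sum_chi_transform)
  also have "\<dots> = (\<Sum>k\<in>P \<union> A. v k)"
    by (rule sum.mono_neutral_right) (use ge in \<open>force simp: P_def A_def\<close>)+
  also have "\<dots> = (\<Sum>k\<in>P. v k) + (\<Sum>k\<in>A. v k)"
    by (rule sum.union_disjoint[OF fin]) (auto simp: P_def A_def)
  also have "(\<Sum>k\<in>A. v k) = (\<Sum>k\<in>A. -1)"
    by (rule sum.cong) (auto simp: A_def)
  finally show "(\<Sum>k\<in>P. v k) = int (card A)" by simp
  \<comment> \<open>The product vanishes at the values \<open>0\<close> and \<open>-1\<close>, so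
    only \<open>P\<close> contributes.\<close>
  have "(\<Sum>k\<in>P. v k * (v k + 1)) = (\<Sum>k\<in>Zp. v k * (v k + 1))"
    by (rule sum.mono_neutral_left) (use ge in \<open>force simp: P_def\<close>)+
  also have "\<dots> = int p * n - m * m"
    by (simp add: distrib_left sum.distrib sum_chi_transform sum_sq_chi_transform)
  finally show "(\<Sum>k\<in>P. v k * (v k + 1)) = int p * n - m * m" .
qed

text \<open>The sum of \<open>v * (v + 1)\<close> would be \<open>2 * p\<close>, at least
  \<open>10\<close>, while a positive part of total at most \<open>2\<close> allows only
  \<open>6\<close>.\<close>

lemma weight_ne_2_0:
  assumes ge: "\<And>k. k \<in> Zp \<Longrightarrow> v k \<ge> -1"
  shows "\<not> (n = 2 \<and> m = 0)"
proof
  assume nm: "n = 2 \<and> m = 0"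
  then have "even m" by simp
  from chi_transform_bounded_below[OF ge this] obtain P a where P: "P \<subseteq> Zp" "0 \<le> a" "a \<le> n"
    "\<And>k. k \<in> P \<Longrightarrow> v k \<ge> 1" "(\<Sum>k\<in>P. v k) = a" "(\<Sum>k\<in>P. v k * (v k + 1)) = int p * n - m * m" by blast
  have "finite P" using P(1) finite_subset by blast
  from sum_mult_Suc_le[OF this P(4,5)] have "int p * 2 \<le> a * (a + 1)" using P(6) nm by simp
  also have "\<dots> \<le> 2 * (2 + 1)" using P(2,3) nm by (intro mult_mono) auto
  finally show False using p_ge_5 by simp
qed

text \<open>The same comparison gives \<open>4 * p - 4 \<le> 20\<close>, hence \<open>p = 5\<close>.
  There a finer estimate forces every positive value to be \<open>3\<close>, although they add up to
  \<open>4\<close>.\<close>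

lemma weight_ne_4_2:
  assumes ge: "\<And>k. k \<in> Zp \<Longrightarrow> v k \<ge> -1"
  shows "\<not> (n = 4 \<and> m * m = 4)"
proof
  assume nm: "n = 4 \<and> m * m = 4"
  then have "even (m * m)" by simp
  then have "even m" by simp
  from chi_transform_bounded_below[OF ge this] obtain P a where P: "P \<subseteq> Zp" "0 \<le> a" "a \<le> n"
    "\<And>k. k \<in> P \<Longrightarrow> v k \<ge> 1" "(\<Sum>k\<in>P. v k) = a" "(\<Sum>k\<in>P. v k * (v k + 1)) = int p * n - m * m" by blast
  have fin: "finite P" using P(1) finite_subset by blast
  from sum_mult_Suc_le[OF this P(4,5)] have "int p * 4 - 4 \<le> a * (a + 1)" using P(6) nm by simp
  also have "\<dots> \<le> 4 * (4 + 1)" using P(2,3) nm by (intro mult_mono) auto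
  finally have "p \<le> 6" by simp
  moreover have "p \<noteq> 6" using p_eq by presburger
  ultimately have "p = 5" using p_ge_5 by linarith
  then have S: "(\<Sum>k\<in>P. v k * (v k + 1)) = 16" using P(6) nm by simp
  have le3: "v k \<le> 3" if k: "k \<in> P" for k
  proof (rule ccontr)
    assume "\<not> v k \<le> 3"
    then have "v k * (v k + 1) \<ge> 4 * (4 + 1)" by (intro mult_mono) auto
    moreover have "v k * (v k + 1) \<le> (\<Sum>k\<in>P. v k * (v k + 1))"
      using k fin P(4) by (intro member_le_sum) force+
    ultimately show False using S by simp
  qed
  have nn: "0 \<le> v k * (3 - v k)" if "k \<in> P" for k
    using le3[OF that] P(4)[OF that] by simp
  \<comment> \<open>Rewrites \<open>v * (v + 1)\<close> as \<open>4 * v - v * (3 - v)\<close>, whose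
    second part is nonnegative for values from \<open>1\<close> to \<open>3\<close>; then
    \<open>a \<le> 4\<close> forces equality throughout.\<close>
  have "16 = (\<Sum>k\<in>P. 4 * v k - v k * (3 - v k))" unfolding S[symmetric] by (simp add: algebra_simps)
  also have "\<dots> = 4 * a - (\<Sum>k\<in>P. v k * (3 - v k))" using P(5) by (simp add: sum_subtractf sum_distrib_left[symmetric])
  finally have eq: "16 = 4 * a - (\<Sum>k\<in>P. v k * (3 - v k))" .
  moreover have "0 \<le> (\<Sum>k\<in>P. v k * (3 - v k))" by (rule sum_nonneg) (rule nn)
  ultimately have a: "a = 4" "(\<Sum>k\<in>P. v k * (3 - v k)) = 0" using P(3) nm by auto
  then have "v k * (3 - v k) = 0" if "k \<in> P" for k
    using sum_nonneg_eq_0_iff[OF fin, of "\<lambda>k. v k * (3 - v k)"] nn that by simp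
  then have "v k = 3" if "k \<in> P" for k using P(4) that by fastforce
  then have "(\<Sum>k\<in>P. v k) = 3 * int (card P)" by simp
  then show False using P(5) a(1) by presburger
qed

text \<open>An integer \<open>u\<close> satisfies \<open>\<bar>u\<bar> \<le> u * u\<close>, and
  \<open>u\<close> and \<open>u * u\<close> have the same parity.\<close>

lemma abs_sum_le_weight: "\<bar>m\<bar> \<le> n" and even_sum_weight: "even (n + m)"
proof -
  have "\<bar>m\<bar> \<le> (\<Sum>j\<in>Zp. \<bar>U j\<bar>)" unfolding m_def by (rule sum_abs)
  also have "\<dots> \<le> n" unfolding n_def
  proof (rule sum_mono)
    fix j show "\<bar>U j\<bar> \<le> U j * U j"
      using mult_left_mono[of 1 "\<bar>U j\<bar>" "\<bar>U j\<bar>"] by (cases "U j = 0") (auto simp: abs_mult_self_eq)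
  qed
  finally show "\<bar>m\<bar> \<le> n" .
  show "even (n + m)" unfolding n_def m_def sum.distrib[symmetric] by (rule dvd_sum) auto
qed

lemma weight_1_imp_delta:
  assumes "periodic U" "n = 1"
  obtains d e where "e = 1 \<or> e = -1" "\<And>k. U k = e * of_bool ([k = d] (mod int p))"
proof -
  have "\<exists>d\<in>Zp. U d \<noteq> 0"
  proof (rule ccontr)
    assume "\<not> (\<exists>d\<in>Zp. U d \<noteq> 0)"
    then have "n = 0" unfolding n_def by simp
    then show False using assms by simp
  qed
  then obtain d where d: "d \<in> Zp" "U d \<noteq> 0" by blast
  have n: "n = U d * U d + (\<Sum>j\<in>Zp - {d}. U j * U j)"
    unfolding n_def using d by (simp add: sum.remove)
  have nn: "0 \<le> (\<Sum>j\<in>Zp - {d}. U j * U j)" by (rule sum_nonneg) simp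
  have "1 \<le> U d * U d" using d(2) by (auto simp: int_one_le_iff_zero_less zero_less_mult_iff)
  then have e: "U d * U d = 1" "(\<Sum>j\<in>Zp - {d}. U j * U j) = 0" using n nn assms(2) by auto
  have z: "U j = 0" if "j \<in> Zp - {d}" for j
    using e(2) that by (subst (asm) sum_nonneg_eq_0_iff) auto
  have "U k = U d * of_bool ([k = d] (mod int p))" for k
  proof (cases "[k = d] (mod int p)")
    case True then show ?thesis using periodicD[OF assms(1)] by simp
  next
    case False
    then have "k mod int p \<in> Zp - {d}" using d(1) mod_in_Zp[of k] by (auto simp: cong_def)
    then show ?thesis using z periodic_mod[OF assms(1), of k] False by force
  qed
  moreover have "U d = 1 \<or> U d = -1" using e(1) by (simp add: square_eq_1_iff)
  ultimately show ?thesis using that by blast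
qed

end

text \<open>Applied when one of the four functions has weight zero: the relations among the totals
  then make products of the other three vanish. One total is \<open>2\<close> or \<open>-2\<close>
  and the others are zero, so all weights are even; with sum \<open>4\<close> this leaves only the
  excluded cases of weight \<open>4\<close> with total \<open>2\<close> or \<open>-2\<close> and
  weight \<open>2\<close> with total zero.\<close>

lemma weight_0_impossible:
  fixes m1 m2 m3 n1 n2 n3 :: int
  assumes "n1 + n2 + n3 = 4" "m1 * m1 + m2 * m2 + m3 * m3 = 4"
    "m1 * m2 = 0" "m1 * m3 = 0" "m2 * m3 = 0"
    "\<bar>m1\<bar> \<le> n1" "\<bar>m2\<bar> \<le> n2" "\<bar>m3\<bar> \<le> n3" "even (n1 + m1)" "even (n2 + m2)" "even (n3 + m3)"
    "\<not> (n1 = 4 \<and> m1 * m1 = 4)" "\<not> (n2 = 4 \<and> m2 * m2 = 4)" "\<not> (n3 = 4 \<and> m3 * m3 = 4)"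
    "\<not> (n1 = 2 \<and> m1 = 0)" "\<not> (n2 = 2 \<and> m2 = 0)" "\<not> (n3 = 2 \<and> m3 = 0)"
  shows False
proof -
  have sq: "\<bar>x\<bar> = 2" if "x * x = 4" for x :: int
    using that power2_eq_iff[of x 2] by (auto simp: power2_eq_square)
  have aux: False if "a + b + c = 4" "x * x = 4" "\<bar>x\<bar> \<le> a" "0 \<le> b" "0 \<le> c" "even (a + x)" "even b" "even c"
     "a \<noteq> 4" "b \<noteq> 2" "c \<noteq> 2" for a b c x :: int
    using that sq[OF that(2)] by presburger
  consider "m1 = 0" "m2 = 0" | "m1 = 0" "m3 = 0" | "m2 = 0" "m3 = 0" using assms(3-5) by auto
  then show False
  proof cases
    case 1 then show False using assms aux[of n3 n1 n2 m3] by auto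
  next
    case 2 then show False using assms aux[of n2 n1 n3 m2] by auto
  next
    case 3 then show False using assms aux[of n1 n2 n3 m1] by auto
  qed
qed

section \<open>Point masses and the pairing of their positions\<close>

lemma corr_delta:
  assumes "\<And>k. U k = e * of_bool ([k = d] (mod int p))" "\<And>k. V k = f * of_bool ([k = g] (mod int p))"
  shows "corr U V t = e * f * of_bool ([t = g - d] (mod int p))"
proof -
  have per: "periodic (\<lambda>k. e * V (k + t))"
    unfolding assms periodic_def cong_def by (metis (no_types, lifting) mod_add_cong)
  have "corr U V t = (\<Sum>k\<in>Zp. (e * V (k + t)) * of_bool ([k = d] (mod int p)))"
    unfolding corr_def assms(1) by (intro sum.cong) auto
  also have "\<dots> = e * V (d + t)" by (rule sum_Zp_delta[OF per])
  finally show ?thesis by (simp add: assms(2) cong_iff_dvd_diff algebra_simps)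
qed

text \<open>At \<open>t = x\<close> the terms with coefficient \<open>e\<close> have the same sign,
  so they can only be cancelled by a term with coefficient \<open>f\<close>.\<close>

lemma cong_pm_of_cancel:
  fixes e f :: int
  assumes "e = 1 \<or> e = -1" "f = 1 \<or> f = -1"
    "\<And>t. e * of_bool ([t = x] (mod int p)) + e * of_bool ([t = - x] (mod int p))
        + f * of_bool ([t = y] (mod int p)) + f * of_bool ([t = - y] (mod int p)) = 0"
  shows "[x = y] (mod int p) \<or> [x = - y] (mod int p)"
  using assms(1,2) assms(3)[of x] by (auto simp: of_bool_def split: if_splits)

text \<open>Each of \<open>A\<close>, \<open>B\<close>, \<open>C\<close> says that one splitting of
  the four points into two pairs has equal pair sums. The hypotheses give at least two of them, and
  adding or subtracting two equates points, since \<open>2\<close> is invertible.\<close>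

lemma pairing_of_cong_pm:
  assumes "[d1 - d0 = d3 - d2] (mod int p) \<or> [d1 - d0 = - (d3 - d2)] (mod int p)"
    "[d2 - d0 = d3 - d1] (mod int p) \<or> [d2 - d0 = - (d3 - d1)] (mod int p)"
    "[d3 - d0 = d2 - d1] (mod int p) \<or> [d3 - d0 = - (d2 - d1)] (mod int p)"
  shows "[d0 = d1] (mod int p) \<and> [d2 = d3] (mod int p) \<or> [d0 = d2] (mod int p) \<and> [d1 = d3] (mod int p)
       \<or> [d0 = d3] (mod int p) \<and> [d1 = d2] (mod int p)"
proof -
  define A where "A \<longleftrightarrow> int p dvd d1 + d2 - d0 - d3"
  define B where "B \<longleftrightarrow> int p dvd d1 + d3 - d0 - d2"
  define C where "C \<longleftrightarrow> int p dvd d2 + d3 - d0 - d1"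
  have comb: "int p dvd x" if "int p dvd y" "int p dvd z" "2 * x = y + z \<or> 2 * x = y - z \<or> 2 * x = - (y + z)" for x y z
  proof (rule dvd_double_imp_dvd)
    show "int p dvd 2 * x" using that(3)
      by (elim disjE) (simp_all only: dvd_add[OF that(1,2)] dvd_diff[OF that(1,2)] dvd_minus_iff)
  qed
  have AB: "[d0 = d1] (mod int p) \<and> [d2 = d3] (mod int p)" if A B
    unfolding cong_iff_dvd_diff by (intro conjI; rule comb[OF that[unfolded A_def B_def]]; arith)
  have AC: "[d0 = d2] (mod int p) \<and> [d1 = d3] (mod int p)" if A C
    unfolding cong_iff_dvd_diff by (intro conjI; rule comb[OF that[unfolded A_def C_def]]; arith)
  have BC: "[d0 = d3] (mod int p) \<and> [d1 = d2] (mod int p)" if B C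
    unfolding cong_iff_dvd_diff by (intro conjI; rule comb[OF that[unfolded B_def C_def]]; arith)
  have "A \<or> B" "A \<or> C" "B \<or> C"
    using assms unfolding A_def B_def C_def cong_iff_dvd_diff by (auto simp: algebra_simps)
  then show ?thesis using AB AC BC by blast
qed

text \<open>The weights of the four quotient functions sum to \<open>4\<close> and none is zero, so
  each is \<open>1\<close> and each function is a signed point mass; the cancelling correlations
  then pair the positions.\<close>

lemma value_distribution:
  fixes c0 c1 c2 c3 :: "int \<Rightarrow> int"
  assumes per: "periodic c0" "periodic c1" "periodic c2" "periodic c3"
    and sum: "(\<Sum>k\<in>Zp. c0 k) = int p" "(\<Sum>k\<in>Zp. c1 k) = int p"
             "(\<Sum>k\<in>Zp. c2 k) = int p" "(\<Sum>k\<in>Zp. c3 k) = int p"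
    and nonneg: "\<And>k. c0 k \<ge> 0" "\<And>k. c1 k \<ge> 0" "\<And>k. c2 k \<ge> 0" "\<And>k. c3 k \<ge> 0"
    and A0: "\<And>t. corr c0 c0 t + corr c1 c1 t + corr c2 c2 t + corr c3 c3 t
                  = 4 * (int p - 1) + 4 * int p * of_bool (int p dvd t)"
    and A1: "\<And>t. corr c0 c1 t + corr c1 c0 t + corr c2 c3 t + corr c3 c2 t = 4 * int p"
    and A2: "\<And>t. corr c0 c2 t + corr c2 c0 t + corr c1 c3 t + corr c3 c1 t = 4 * int p"
    and A3: "\<And>t. corr c0 c3 t + corr c3 c0 t + corr c1 c2 t + corr c2 c1 t = 4 * int p"
  obtains d0 d1 d2 d3 e0 e1 e2 e3 where
    "\<forall>e\<in>{e0,e1,e2,e3}. e = 1 \<or> e = -1"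
    "\<And>k. c0 k = 1 + e0 * chi (k - d0)" "\<And>k. c1 k = 1 + e1 * chi (k - d1)"
    "\<And>k. c2 k = 1 + e2 * chi (k - d2)" "\<And>k. c3 k = 1 + e3 * chi (k - d3)"
    "[d0 = d1] (mod int p) \<and> [d2 = d3] (mod int p) \<or> [d0 = d2] (mod int p) \<and> [d1 = d3] (mod int p)
       \<or> [d0 = d3] (mod int p) \<and> [d1 = d2] (mod int p)"
proof -
  obtain U0 U1 U2 U3 :: "int \<Rightarrow> int" where
    perU: "periodic U0" "periodic U1" "periodic U2" "periodic U3" and
    rep: "\<And>k. c0 k = 1 + (\<Sum>j\<in>Zp. U0 j * chi (k - j))"
    "\<And>k. c1 k = 1 + (\<Sum>j\<in>Zp. U1 j * chi (k - j))"
    "\<And>k. c2 k = 1 + (\<Sum>j\<in>Zp. U2 j * chi (k - j))"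
    "\<And>k. c3 k = 1 + (\<Sum>j\<in>Zp. U3 j * chi (k - j))" and
    C: "\<And>t. corr U0 U0 t + corr U1 U1 t + corr U2 U2 t + corr U3 U3 t = 4 * of_bool (int p dvd t)"
    "\<And>t. corr U0 U1 t + corr U1 U0 t + corr U2 U3 t + corr U3 U2 t = 0"
    "\<And>t. corr U0 U2 t + corr U2 U0 t + corr U1 U3 t + corr U3 U1 t = 0"
    "\<And>t. corr U0 U3 t + corr U3 U0 t + corr U1 U2 t + corr U2 U1 t = 0"
    by (rule twist_integral_quotients[OF per sum A0 A1 A2 A3]) blast+
  define n where "n U = (\<Sum>j\<in>Zp. U j * U j)" for U :: "int \<Rightarrow> int"
  define m where "m U = (\<Sum>j\<in>Zp. U j)" for U :: "int \<Rightarrow> int"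
  have sum_n: "n U0 + n U1 + n U2 + n U3 = 4"
    using C(1)[of 0] by (simp add: corr_def n_def)
  \<comment> \<open>Summed over all shifts, the correlation identities become relations among the
    totals alone.\<close>
  have mm: "(\<Sum>t\<in>Zp. corr U V t) = m U * m V" if "periodic V" for U V
    using sum_corr[OF that] by (simp add: m_def)
  have "(\<Sum>t\<in>Zp. 4 * of_bool ([t = 0] (mod int p))) = (4::int)"
    by (rule sum_Zp_delta) (simp add: periodic_def)
  then have "(\<Sum>t\<in>Zp. corr U0 U0 t + corr U1 U1 t + corr U2 U2 t + corr U3 U3 t) = 4"
    unfolding C cong_0_iff .
  then have m0: "m U0 * m U0 + m U1 * m U1 + m U2 * m U2 + m U3 * m U3 = 4"
    by (simp add: sum.distrib mm perU)
  have "(\<Sum>t\<in>Zp. corr U0 U1 t + corr U1 U0 t + corr U2 U3 t + corr U3 U2 t) = 0" unfolding C by simp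
  then have m1: "m U0 * m U1 + m U2 * m U3 = 0" by (simp add: sum.distrib mm perU mult.commute)
  have "(\<Sum>t\<in>Zp. corr U0 U2 t + corr U2 U0 t + corr U1 U3 t + corr U3 U1 t) = 0" unfolding C by simp
  then have m2: "m U0 * m U2 + m U1 * m U3 = 0" by (simp add: sum.distrib mm perU mult.commute)
  have "(\<Sum>t\<in>Zp. corr U0 U3 t + corr U3 U0 t + corr U1 U2 t + corr U2 U1 t) = 0" unfolding C by simp
  then have m3: "m U0 * m U3 + m U1 * m U2 = 0" by (simp add: sum.distrib mm perU mult.commute)
  have ge: "(\<Sum>j\<in>Zp. U j * chi (k - j)) \<ge> -1" if "U \<in> {U0,U1,U2,U3}" for U k
    using that nonneg[of k] rep[of k] by auto
  have ex: "\<not> (n U = 4 \<and> m U * m U = 4)" "\<not> (n U = 2 \<and> m U = 0)" if "U \<in> {U0,U1,U2,U3}" for U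
    unfolding n_def m_def using weight_ne_4_2 weight_ne_2_0 ge[OF that] by blast+
  have nm: "\<bar>m U\<bar> \<le> n U" "even (n U + m U)" for U
    unfolding n_def m_def by (rule abs_sum_le_weight, rule even_sum_weight)
  have n0: "0 \<le> n U" for U using nm(1)[of U] by linarith
  have z: "m U = 0" if "n U = 0" for U using nm(1)[of U] that by simp
  have "n U0 \<noteq> 0"
  proof
    assume "n U0 = 0"
    then show False
      using sum_n m0 m1 m2 m3 z[of U0] weight_0_impossible[of "n U1" "n U2" "n U3" "m U1" "m U2" "m U3"]
        nm ex by simp
  qed
  moreover have "n U1 \<noteq> 0"
  proof
    assume "n U1 = 0"
    then show False
      using sum_n m0 m1 m2 m3 z[of U1] weight_0_impossible[of "n U0" "n U2" "n U3" "m U0" "m U2" "m U3"]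
        nm ex by simp
  qed
  moreover have "n U2 \<noteq> 0"
  proof
    assume "n U2 = 0"
    then show False
      using sum_n m0 m1 m2 m3 z[of U2] weight_0_impossible[of "n U0" "n U1" "n U3" "m U0" "m U1" "m U3"]
        nm ex by simp
  qed
  moreover have "n U3 \<noteq> 0"
  proof
    assume "n U3 = 0"
    then show False
      using sum_n m0 m1 m2 m3 z[of U3] weight_0_impossible[of "n U0" "n U1" "n U2" "m U0" "m U1" "m U2"]
        nm ex by simp
  qed
  ultimately have n1: "n U0 = 1" "n U1 = 1" "n U2 = 1" "n U3 = 1"
    using sum_n n0[of U0] n0[of U1] n0[of U2] n0[of U3] by auto
  obtain d0 e0 where U0: "e0 = 1 \<or> e0 = -1" "\<And>k. U0 k = e0 * of_bool ([k = d0] (mod int p))"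
    by (rule weight_1_imp_delta[OF perU(1) n1(1)[unfolded n_def]]) blast
  obtain d1 e1 where U1: "e1 = 1 \<or> e1 = -1" "\<And>k. U1 k = e1 * of_bool ([k = d1] (mod int p))"
    by (rule weight_1_imp_delta[OF perU(2) n1(2)[unfolded n_def]]) blast
  obtain d2 e2 where U2: "e2 = 1 \<or> e2 = -1" "\<And>k. U2 k = e2 * of_bool ([k = d2] (mod int p))"
    by (rule weight_1_imp_delta[OF perU(3) n1(3)[unfolded n_def]]) blast
  obtain d3 e3 where U3: "e3 = 1 \<or> e3 = -1" "\<And>k. U3 k = e3 * of_bool ([k = d3] (mod int p))"
    by (rule weight_1_imp_delta[OF perU(4) n1(4)[unfolded n_def]]) blast
  have tr: "(\<Sum>j\<in>Zp. U j * chi (k - j)) = e * chi (k - d)" if "\<And>k. U k = e * of_bool ([k = d] (mod int p))" for U e d k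
  proof -
    have "periodic (\<lambda>j. e * chi (k - j))" unfolding periodic_def
      by (auto intro!: periodicD[OF chi_periodic] cong_diff)
    from sum_Zp_delta[OF this, of d] show ?thesis unfolding that by (simp add: mult_ac)
  qed
  show ?thesis
  proof (rule that[of e0 e1 e2 e3 d0 d1 d2 d3])
    show "\<forall>e\<in>{e0,e1,e2,e3}. e = 1 \<or> e = -1" using U0 U1 U2 U3 by auto
    show "c0 k = 1 + e0 * chi (k - d0)" for k using rep(1) tr[OF U0(2)] by simp
    show "c1 k = 1 + e1 * chi (k - d1)" for k using rep(2) tr[OF U1(2)] by simp
    show "c2 k = 1 + e2 * chi (k - d2)" for k using rep(3) tr[OF U2(2)] by simp
    show "c3 k = 1 + e3 * chi (k - d3)" for k using rep(4) tr[OF U3(2)] by simp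
    note cd = corr_delta[OF U0(2) U1(2)] corr_delta[OF U1(2) U0(2)] corr_delta[OF U2(2) U3(2)] corr_delta[OF U3(2) U2(2)]
      corr_delta[OF U0(2) U2(2)] corr_delta[OF U2(2) U0(2)] corr_delta[OF U1(2) U3(2)] corr_delta[OF U3(2) U1(2)]
      corr_delta[OF U0(2) U3(2)] corr_delta[OF U3(2) U0(2)] corr_delta[OF U1(2) U2(2)] corr_delta[OF U2(2) U1(2)]
    have "[d1 - d0 = d3 - d2] (mod int p) \<or> [d1 - d0 = - (d3 - d2)] (mod int p)"
      using C(2) U0(1) U1(1) U2(1) U3(1) unfolding cd
      by (intro cong_pm_of_cancel[of "e0 * e1" "e2 * e3"]) (auto simp: mult.commute)
    moreover have "[d2 - d0 = d3 - d1] (mod int p) \<or> [d2 - d0 = - (d3 - d1)] (mod int p)"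
      using C(3) U0(1) U1(1) U2(1) U3(1) unfolding cd
      by (intro cong_pm_of_cancel[of "e0 * e2" "e1 * e3"]) (auto simp: mult.commute)
    moreover have "[d3 - d0 = d2 - d1] (mod int p) \<or> [d3 - d0 = - (d2 - d1)] (mod int p)"
      using C(4) U0(1) U1(1) U2(1) U3(1) unfolding cd
      by (intro cong_pm_of_cancel[of "e0 * e3" "e1 * e2"]) (auto simp: mult.commute)
    ultimately show "[d0 = d1] (mod int p) \<and> [d2 = d3] (mod int p) \<or> [d0 = d2] (mod int p) \<and> [d1 = d3] (mod int p)
       \<or> [d0 = d3] (mod int p) \<and> [d1 = d2] (mod int p)"
      by (rule pairing_of_cong_pm)
  qed
qed

section \<open>Functions with quadratic value distribution\<close>

text \<open>Lagrange's bound on the number of roots over a field, for integer polynomials modulo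
  \<open>p\<close>: synthetic division splits off a root with a remainder divisible by
  \<open>p\<close>, and the quotient is treated by induction.\<close>

lemma coeffs_dvd_of_many_roots:
  fixes q :: "int poly"
  assumes "degree q \<le> n" "A \<subseteq> Zp" "n < card A" "\<And>a. a \<in> A \<Longrightarrow> int p dvd poly q a"
  shows "int p dvd coeff q i"
  using assms
proof (induction n arbitrary: q A i)
  case 0
  then obtain c where q: "q = [:c:]" using degree_eq_zeroE[of q] by auto
  obtain a where "a \<in> A" using 0(3) by fastforce
  then have "int p dvd c" using 0(4) q by fastforce
  then show ?case by (auto simp: q coeff_pCons split: nat.splits)
next
  case (Suc n)
  obtain a where a: "a \<in> A" using Suc.prems(3) by fastforce
  define s where "s = synthetic_div q a"
  have q: "q = [:- a, 1:] * s + [:poly q a:]"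
    unfolding s_def by (rule synthetic_div_correct'[symmetric])
  have fin: "finite A" using Suc.prems(2) finite_subset by blast
  have "[:int p:] dvd s"
    unfolding const_poly_dvd_iff
  proof
    fix i
    show "int p dvd coeff s i"
    proof (rule Suc.IH[of s "A - {a}"])
      show "degree s \<le> n" using Suc.prems(1) by (simp add: s_def degree_synthetic_div)
      show "n < card (A - {a})" using Suc.prems(3) a fin by simp
      fix b assume b: "b \<in> A - {a}"
      have "poly q b = (b - a) * poly s b + poly q a"
        by (subst q) (simp add: algebra_simps)
      then have "int p dvd (b - a) * poly s b"
        using Suc.prems(4)[of a] Suc.prems(4)[of b] a b by (metis DiffD1 dvd_add_left_iff)
      moreover have "\<not> int p dvd b - a"
        using Zp_cong_eq[of b a] a b Suc.prems(2) unfolding cong_iff_dvd_diff by blast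
      ultimately show "int p dvd poly s b" using prime_int_p prime_dvd_mult_iff by blast
    qed (use Suc.prems(2) in auto)
  qed
  moreover have "[:int p:] dvd [:poly q a:]"
    using Suc.prems(4)[OF a] by simp
  ultimately have "[:int p:] dvd q" by (subst q) (intro dvd_add dvd_mult)
  then show ?case by (simp add: const_poly_dvd_iff)
qed

lemma inverse_mod_p: "\<not> int p dvd x \<Longrightarrow> \<exists>y. [x * y = 1] (mod int p)"
  using cong_solve_coprime_int prime_imp_coprime[OF prime_int_p] coprime_commute by blast

text \<open>The number of points of the graph of \<open>f\<close> on a line of slope
  \<open>-a\<close>; for fixed \<open>a\<close> these are the counts to which
  \<open>value_distribution\<close> is applied.\<close>

definition val_count :: "(int \<Rightarrow> int) \<Rightarrow> int \<Rightarrow> int \<Rightarrow> int" where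
  "val_count f a k = (\<Sum>x\<in>Zp. of_bool ([f x + a * x = k] (mod int p)))"

lemma sum_power_val_count:
  "[(\<Sum>x\<in>Zp. (f x + a * x) ^ m) = (\<Sum>k\<in>Zp. val_count f a k * k ^ m)] (mod int p)"
proof -
  have "(\<Sum>k\<in>Zp. val_count f a k * k ^ m)
      = (\<Sum>x\<in>Zp. \<Sum>k\<in>Zp. k ^ m * of_bool ([f x + a * x = k] (mod int p)))"
    unfolding val_count_def sum_distrib_right by (subst sum.swap) (simp add: mult.commute)
  also have "\<dots> = (\<Sum>x\<in>Zp. ((f x + a * x) mod int p) ^ m)"
  proof (rule sum.cong[OF refl])
    fix x
    have "(\<Sum>k\<in>Zp. k ^ m * of_bool ([f x + a * x = k] (mod int p)))
        = (\<Sum>k\<in>Zp. if k = (f x + a * x) mod int p then k ^ m else 0)"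
      by (rule sum.cong) (auto simp: cong_def)
    then show "(\<Sum>k\<in>Zp. k ^ m * of_bool ([f x + a * x = k] (mod int p))) = ((f x + a * x) mod int p) ^ m"
      using p_ge_5 by simp
  qed
  also have "[\<dots> = (\<Sum>x\<in>Zp. (f x + a * x) ^ m)] (mod int p)"
    by (intro cong_sum cong_pow) (simp add: cong_def)
  finally show ?thesis by (rule cong_sym)
qed

text \<open>After Euler's criterion the summand has degree at most \<open>r + m\<close>, which
  reaches \<open>p - 1\<close> only for \<open>m = r\<close>.\<close>

lemma sum_power_chi_distribution:
  assumes "m \<le> r"
  shows "[(\<Sum>k\<in>Zp. (1 + e * chi (k - d)) * k ^ m) = - (if m = r then e else 0)] (mod int p)"
proof -
  define q where "q = [:0,1:] ^ m + smult e ([:-d,1:] ^ r * [:0,1:] ^ m)"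
  have 1: "[(\<Sum>k\<in>Zp. (1 + e * chi (k - d)) * k ^ m) = (\<Sum>k\<in>Zp. poly q k)] (mod int p)"
  proof (rule cong_sum)
    fix k
    have "[(1 + e * chi (k - d)) * k ^ m = (1 + e * (k - d) ^ r) * k ^ m] (mod int p)"
      by (intro cong_mult cong_add cong_refl chi_cong)
    then show "[(1 + e * chi (k - d)) * k ^ m = poly q k] (mod int p)"
      by (simp add: q_def algebra_simps)
  qed
  have mon: "[:0,1:] ^ m = monom (1::int) m" by (simp add: monom_altdef)
  have d1: "degree ([:-d,1:] ^ r * [:0,1:] ^ m) = r + m"
    by (simp add: degree_mult_eq degree_power_eq)
  have "degree q \<le> p - 1"
    unfolding q_def using assms p_eq d1
    by (intro degree_add_le order_trans[OF degree_smult_le]) (auto simp: degree_power_eq)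
  then have 2: "[(\<Sum>k\<in>Zp. poly q k) = - coeff q (p - 1)] (mod int p)" by (rule sum_poly_cong)
  have "coeff q (p - 1) = (if m = r then e else 0)"
  proof -
    have "coeff ([:0,1:] ^ m) (p - 1) = (0::int)"
      using assms p_eq r_ge by (simp add: mon)
    moreover have "coeff ([:-d,1:] ^ r * [:0,1:] ^ m) (p - 1) = (if m = r then 1 else 0)"
    proof (cases "m = r")
      case True
      then have "p - 1 = degree ([:-d,1:] ^ r * [:0,1:] ^ m)" using d1 p_eq by simp
      then show ?thesis using True
        by (simp only: lead_coeff_mult lead_coeff_power) simp
    next
      case False
      then show ?thesis using assms d1 p_eq by (intro trans[OF coeff_eq_0]) auto
    qed
    ultimately show ?thesis by (simp add: q_def)
  qed
  then show ?thesis using cong_trans[OF 1 2] by (simp only:)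
qed

context
  fixes f e d :: "int \<Rightarrow> int"
  assumes f: "periodic f" and e: "\<And>a. e a = 1 \<or> e a = -1"
    and count: "\<And>a k. val_count f a k = 1 + e a * chi (k - d a)"
begin

text \<open>With \<open>m = i + j\<close>, the sum of \<open>(f x + a * x) ^ m\<close> over
  \<open>x\<close> is a polynomial in \<open>a\<close> of degree at most \<open>r\<close>. Modulo
  \<open>p\<close> its values are \<open>0\<close>, or \<open>- e a\<close> when
  \<open>m = r\<close>, so up to a constant it has too many roots. The excluded pair
  \<open>i = r\<close>, \<open>j = 0\<close> belongs to the constant coefficient in the second
  case.\<close>

lemma mixed_moment_vanishes:
  assumes ij: "i + j \<le> r" "1 \<le> j \<or> i + j < r"
  shows "int p dvd (\<Sum>x\<in>Zp. f x ^ i * x ^ j)"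
proof -
  define m where "m = i + j"
  define Q where "Q = (\<Sum>x\<in>Zp. [:f x, x:] ^ m)"
  have degQ: "degree Q \<le> r"
    unfolding Q_def
  proof (rule degree_sum_le)
    fix x
    have "degree ([:f x, x:] ^ m) \<le> degree [:f x, x:] * m" by (rule degree_power_le)
    also have "\<dots> \<le> 1 * m" by (intro mult_right_mono) auto
    also have "\<dots> \<le> r" using ij by (simp add: m_def)
    finally show "degree ([:f x, x:] ^ m) \<le> r" .
  qed simp
  have Q: "[poly Q a = - (if m = r then e a else 0)] (mod int p)" for a
  proof -
    have "poly Q a = (\<Sum>x\<in>Zp. (f x + a * x) ^ m)" by (simp add: Q_def poly_sum)
    also have "[\<dots> = (\<Sum>k\<in>Zp. val_count f a k * k ^ m)] (mod int p)" by (rule sum_power_val_count)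
    also have "[(\<Sum>k\<in>Zp. val_count f a k * k ^ m) = - (if m = r then e a else 0)] (mod int p)"
      unfolding count using ij by (intro sum_power_chi_distribution) (simp add: m_def)
    finally show ?thesis .
  qed
  have "int p dvd coeff Q j"
  proof (cases "m = r")
    case False
    show ?thesis
      by (rule coeffs_dvd_of_many_roots[OF degQ, of Zp]) (use Q False p_eq in \<open>auto simp: cong_0_iff\<close>)
  next
    case True
    define A where "A s = {a\<in>Zp. e a = s}" for s
    have sub: "A s \<subseteq> Zp" for s by (auto simp: A_def)
    then have fin: "finite (A s)" for s using finite_subset by blast
    have "Zp = A 1 \<union> A (-1)" using e by (auto simp: A_def)
    then have "card Zp \<le> card (A 1) + card (A (-1))" by (metis card_Un_le)
    \<comment> \<open>Pigeonhole: one of the two signs occurs at more than \<open>r\<close> of the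
      \<open>2 * r + 1\<close> points, enough to force all nonconstant coefficients to vanish modulo
      \<open>p\<close>.\<close>
    then have "r < card (A 1) \<or> r < card (A (-1))" using p_eq by simp linarith
    then obtain s where s: "r < card (A s)" by blast
    have "int p dvd coeff (Q + [:s:]) j"
    proof (rule coeffs_dvd_of_many_roots[OF _ sub s])
      show "degree (Q + [:s:]) \<le> r" using degQ by (intro degree_add_le) auto
      fix a assume "a \<in> A s"
      then show "int p dvd poly (Q + [:s:]) a" using Q[of a] True by (simp add: A_def cong_iff_dvd_diff)
    qed
    moreover have "j \<ge> 1" using ij True by (auto simp: m_def)
    ultimately show ?thesis by (simp add: coeff_pCons split: nat.splits)
  qed
  also have "coeff Q j = of_nat (m choose j) * (\<Sum>x\<in>Zp. f x ^ i * x ^ j)"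
    unfolding Q_def coeff_sum
    by (simp add: coeff_linear_poly_power m_def sum_distrib_left mult_ac)
  finally have "int p dvd of_nat (m choose j) * (\<Sum>x\<in>Zp. f x ^ i * x ^ j)" .
  moreover have "\<not> int p dvd of_nat (m choose j)"
  proof -
    have "\<not> p dvd fact m" using ij p_eq prime_p r_ge by (subst prime_dvd_fact_iff) (auto simp: m_def)
    moreover have "m choose j dvd fact m"
      using binomial_fact_lemma[of j m] by (metis dvd_triv_right le_add2 m_def)
    ultimately have "\<not> p dvd m choose j" by (meson dvd_trans)
    then show ?thesis by (simp only: int_dvd_int_iff not_False_eq_True)
  qed
  ultimately show ?thesis using prime_int_p prime_dvd_mult_iff by blast
qed

section \<open>Polynomial interpolation and the degree bound\<close>

lemma interpolation: "\<exists>G. degree G \<le> p - 1 \<and> (\<forall>x. [poly G x = f x] (mod int p))"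
proof (intro exI conjI allI)
  \<comment> \<open>By Fermat's theorem, \<open>1 - (x - c) ^ (p - 1)\<close> is the indicator of
    \<open>x = c\<close> modulo \<open>p\<close>.\<close>
  define G where "G = (\<Sum>c\<in>Zp. smult (f c) (1 - [:-c,1:] ^ (p - 1)))"
  show "degree G \<le> p - 1" unfolding G_def
    by (intro degree_sum_le order_trans[OF degree_smult_le] degree_diff_le) (auto simp: degree_power_eq)
  fix x
  have "poly G x = (\<Sum>c\<in>Zp. f c * (1 - (x - c) ^ (p - 1)))"
    by (simp add: G_def poly_sum)
  also have "[\<dots> = (\<Sum>c\<in>Zp. f c * of_bool ([c = x] (mod int p)))] (mod int p)"
  proof (rule cong_sum, rule cong_scalar_left)
    fix c
    show "[1 - (x - c) ^ (p - 1) = of_bool ([c = x] (mod int p))] (mod int p)"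
    proof (cases "[c = x] (mod int p)")
      case True
      then have "int p dvd x - c" by (simp add: cong_iff_dvd_diff dvd_diff_commute)
      then have "int p dvd (x - c) ^ (p - 1)" using p_ge_5 prime_int_p by (subst prime_dvd_power_iff) auto
      then show ?thesis using True by (simp add: cong_iff_dvd_diff)
    next
      case False
      then have nd: "\<not> int p dvd x - c" by (simp add: cong_iff_dvd_diff dvd_diff_commute)
      define y where "y = nat ((x - c) mod int p)"
      have y: "int y = (x - c) mod int p" using p_ge_5 by (simp add: y_def)
      then have "\<not> int p dvd int y" using nd by (simp add: dvd_mod_iff)
      then have "\<not> p dvd y" by (simp only: int_dvd_int_iff not_False_eq_True)
      then have "[y ^ (p - 1) = 1] (mod p)" using fermat_theorem prime_p by blast
      then have "[int (y ^ (p - 1)) = int 1] (mod int p)" by (subst cong_int_iff)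
      then have "[int y ^ (p - 1) = 1] (mod int p)" by simp
      moreover have "[int y = x - c] (mod int p)" by (simp add: y cong_def)
      ultimately have "[(x - c) ^ (p - 1) = 1] (mod int p)"
        by (meson cong_pow cong_sym cong_trans)
      then have "[1 - (x - c) ^ (p - 1) = 1 - 1] (mod int p)" by (intro cong_diff cong_refl)
      then show ?thesis using False by simp
    qed
  qed
  also have "(\<Sum>c\<in>Zp. f c * of_bool ([c = x] (mod int p))) = f x" by (rule sum_Zp_delta[OF f])
  finally show "[poly G x = f x] (mod int p)" .
qed

text \<open>Replaces the degree over the residue field: in an interpolant of minimal degree the
  leading monomial cannot be dropped, so its coefficient is nonzero modulo \<open>p\<close> unless
  the degree is zero.\<close>

lemma minimal_interpolation:
  obtains G where "degree G \<le> p - 1" "\<And>x. [poly G x = f x] (mod int p)"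
    "degree G = 0 \<or> \<not> int p dvd lead_coeff G"
proof -
  define R where "R G \<longleftrightarrow> (\<forall>x. [poly G x = f x] (mod int p))" for G :: "int poly"
  obtain G0 where G0: "degree G0 \<le> p - 1" "R G0" using interpolation R_def by blast
  define G where "G = arg_min degree R"
  have G: "R G" "\<And>H. R H \<Longrightarrow> degree G \<le> degree H"
    using arg_min_nat_lemma[of R G0 degree] G0(2) unfolding G_def by auto
  have "degree G = 0 \<or> \<not> int p dvd lead_coeff G"
  proof (rule ccontr)
    assume *: "\<not> (degree G = 0 \<or> \<not> int p dvd lead_coeff G)"
    define H where "H = G - monom (lead_coeff G) (degree G)"
    have "R H" unfolding R_def
    proof
      fix x
      have "[poly H x = poly G x] (mod int p)"
        using * by (simp add: H_def poly_monom cong_iff_dvd_diff)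
      then show "[poly H x = f x] (mod int p)" using G(1) cong_trans unfolding R_def by blast
    qed
    moreover have "degree H < degree G"
    proof (rule degree_lessI)
      show "H \<noteq> 0 \<or> 0 < degree G" using * by simp
      show "\<forall>k\<ge>degree G. coeff H k = 0" by (auto simp: H_def coeff_eq_0)
    qed
    ultimately show False using G(2) by fastforce
  qed
  then show ?thesis using that[of G] G G0 unfolding R_def by (meson le_trans)
qed

text \<open>The exponents \<open>i, j\<close> below are chosen so that \<open>G ^ i * X ^ j\<close> has degree exactly \<open>p - 1\<close>,
  which makes its sum over the field the negated leading coefficient.\<close>

lemma interpolation_degree_le_2:
  assumes G: "degree G \<le> p - 1" "\<And>x. [poly G x = f x] (mod int p)"
    "degree G = 0 \<or> \<not> int p dvd lead_coeff G"
  shows "degree G \<le> 2"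
proof (rule ccontr)
  assume d: "\<not> degree G \<le> 2"
  define D where "D = degree G"
  obtain i j where ij: "i * D + j = p - 1" "i + j \<le> r" "1 \<le> j \<or> i + j < r"
  proof (cases "D \<le> r")
    case False
    show ?thesis
      by (rule that[of 1 "p - 1 - D"]) (use False G(1) p_eq r_ge in \<open>auto simp: D_def\<close>)
  next
    case True
    \<comment> \<open>Division of \<open>p - 1 = 2 * r\<close> by \<open>D\<close>. For
      \<open>D \<ge> 3\<close> quotient plus remainder is at most \<open>r\<close>; for
      \<open>D = 2\<close> the result would be the excluded pair \<open>i = r\<close>,
      \<open>j = 0\<close>, which is why quadratics survive.\<close>
    define i where "i = (2 * r) div D"
    define j where "j = (2 * r) mod D"
    have D3: "3 \<le> D" using d by (simp add: D_def)
    have eq: "i * D + j = 2 * r" by (simp add: i_def j_def)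
    have "j < D" using D3 by (simp add: j_def)
    have "2 \<le> i" unfolding i_def using True D3 by (simp add: less_eq_div_iff_mult_less_eq)
    then have "2 * (D - 2) \<le> i * (D - 2)" by (rule mult_right_mono) simp
    then have "j \<le> i * (D - 2)" using \<open>j < D\<close> D3 by linarith
    moreover have "i * D = i * (D - 2) + 2 * i" using D3 by (simp add: diff_mult_distrib2)
    ultimately have "i + j \<le> r" using eq by linarith
    moreover have "i < r" if "j = 0"
    proof -
      have "i * 3 \<le> i * D" using D3 by simp
      then show ?thesis using eq that \<open>2 \<le> i\<close> by linarith
    qed
    ultimately show ?thesis using that[of i j] eq p_eq by force
  qed
  define q where "q = G ^ i * [:0,1:] ^ j"
  have "G \<noteq> 0" using d by auto
  then have dq: "degree q = p - 1"
    unfolding q_def using ij(1) by (simp add: degree_mult_eq degree_power_eq D_def)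
  have "[(\<Sum>x\<in>Zp. poly q x) = - coeff q (p - 1)] (mod int p)"
    by (rule sum_poly_cong) (simp add: dq)
  moreover have "[(\<Sum>x\<in>Zp. poly q x) = (\<Sum>x\<in>Zp. f x ^ i * x ^ j)] (mod int p)"
    by (rule cong_sum) (simp add: q_def, intro cong_mult cong_pow G(2) cong_refl)
  ultimately have "int p dvd coeff q (p - 1)"
    using mixed_moment_vanishes[OF ij(2,3)] by (metis cong_dvd_iff dvd_minus_iff)
  moreover have "coeff q (p - 1) = lead_coeff G ^ i"
    unfolding dq[symmetric] unfolding q_def by (simp only: lead_coeff_mult lead_coeff_power) simp
  ultimately have "int p dvd lead_coeff G" using prime_int_p prime_dvd_power by metis
  then show False using G(3) d by simp
qed

text \<open>If the quadratic coefficient vanished, \<open>f\<close> would be affine and for one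
  slope a single value would be taken \<open>p\<close> times, but all counts are at most
  \<open>2\<close>.\<close>

lemma chi_distribution_imp_quadratic:
  obtains \<alpha> \<beta> \<gamma> where "\<not> int p dvd \<alpha>" "\<And>x. [f x = \<alpha> * x\<^sup>2 + \<beta> * x + \<gamma>] (mod int p)"
proof -
  obtain G where G: "degree G \<le> p - 1" "\<And>x. [poly G x = f x] (mod int p)"
    "degree G = 0 \<or> \<not> int p dvd lead_coeff G" by (rule minimal_interpolation) blast
  have "degree G \<le> 2" by (rule interpolation_degree_le_2[OF G])
  then have "poly G x = coeff G 2 * x\<^sup>2 + coeff G 1 * x + coeff G 0" for x
    by (simp add: poly_eq_sum_coeff[of G 2] numeral_2_eq_2)
  then have q: "[f x = coeff G 2 * x\<^sup>2 + coeff G 1 * x + coeff G 0] (mod int p)" for x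
    using G(2) cong_sym by metis
  have "\<not> int p dvd coeff G 2"
  proof
    assume *: "int p dvd coeff G 2"
    have "[f x + (- coeff G 1) * x = coeff G 0] (mod int p)" for x
    proof -
      have "[f x + (- coeff G 1) * x = coeff G 2 * x\<^sup>2 + coeff G 1 * x + coeff G 0 + (- coeff G 1) * x] (mod int p)"
        by (intro cong_add q cong_refl)
      also have "[coeff G 2 * x\<^sup>2 + coeff G 1 * x + coeff G 0 + (- coeff G 1) * x = coeff G 0] (mod int p)"
        using * by (simp add: cong_iff_dvd_diff)
      finally show ?thesis .
    qed
    then have "val_count f (- coeff G 1) (coeff G 0) = int p"
      unfolding val_count_def by simp
    moreover have "1 + e a * chi k \<le> 2" for a k
      using e[of a] abs_chi_le[of k] by auto
    ultimately have "int p \<le> 2" unfolding count by metis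
    then show False using p_ge_5 by simp
  qed
  then show ?thesis using that q by blast
qed

text \<open>Completing the square: the vertex value of \<open>f x + a * x\<close> is attained
  exactly once, so \<open>chi\<close> vanishes there, which identifies \<open>d a\<close> with the
  vertex value. As a function of \<open>a\<close> this is again quadratic, and its coefficients
  allow \<open>f\<close> to be recovered.\<close>

lemma chi_distribution_center:
  obtains A B C where "\<not> int p dvd A" "\<And>a. [d a = A * a\<^sup>2 + B * a + C] (mod int p)"
    "\<And>x. [4 * A * f x = 4 * A * C - (x - B)\<^sup>2] (mod int p)"
proof -
  obtain \<alpha> \<beta> \<gamma> where \<alpha>: "\<not> int p dvd \<alpha>" and q: "\<And>x. [f x = \<alpha> * x\<^sup>2 + \<beta> * x + \<gamma>] (mod int p)"
    by (rule chi_distribution_imp_quadratic) blast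
  have "\<not> int p dvd 4 * \<alpha>"
    using \<alpha> prime_int_p not_dvd_small[of 4] p_ge_5 by (simp add: prime_dvd_mult_iff)
  then obtain I where I: "[4 * \<alpha> * I = 1] (mod int p)" using inverse_mod_p by blast
  define A where "A = - I"
  obtain z where z: "4 * \<alpha> * A = -1 + int p * z"
  proof -
    have "int p dvd 4 * \<alpha> * I - 1" using I by (simp add: cong_iff_dvd_diff)
    then obtain k where "4 * \<alpha> * I - 1 = int p * k" by (rule dvdE)
    then show ?thesis using that[of "- k"] by (simp add: A_def)
  qed
  show ?thesis
  proof (rule that[of A "2 * A * \<beta>" "A * \<beta>\<^sup>2 + \<gamma>"])
    show "\<not> int p dvd A"
    proof
      assume "int p dvd A"
      then have "int p dvd 4 * \<alpha> * A" by simp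
      then have "int p dvd 1" unfolding z by (metis add_uminus_conv_diff dvd_add_left_iff dvd_minus_iff dvd_triv_left)
      then show False using p_ge_5 by simp
    qed
    fix x
    have "[4 * A * f x = 4 * A * (\<alpha> * x\<^sup>2 + \<beta> * x + \<gamma>)] (mod int p)"
      by (intro cong_scalar_left q)
    also have "4 * A * (\<alpha> * x\<^sup>2 + \<beta> * x + \<gamma>) = (4 * \<alpha> * A) * x\<^sup>2 + 4 * A * (\<beta> * x + \<gamma>)"
      by (simp add: algebra_simps)
    also have "[\<dots> = 4 * A * (A * \<beta>\<^sup>2 + \<gamma>) - (x - 2 * A * \<beta>)\<^sup>2] (mod int p)"
    proof -
      have "(4 * \<alpha> * A) * x\<^sup>2 + 4 * A * (\<beta> * x + \<gamma>) - (4 * A * (A * \<beta>\<^sup>2 + \<gamma>) - (x - 2 * A * \<beta>)\<^sup>2)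
         = int p * (z * x\<^sup>2)"
        unfolding z by (simp add: algebra_simps power2_eq_square)
      then show ?thesis by (simp add: cong_iff_dvd_diff)
    qed
    finally show "[4 * A * f x = 4 * A * (A * \<beta>\<^sup>2 + \<gamma>) - (x - 2 * A * \<beta>)\<^sup>2] (mod int p)" .
  next
    fix a
    \<comment> \<open>\<open>x0\<close> is the vertex, because \<open>A\<close> represents
      \<open>-1 / (4 * \<alpha>)\<close> modulo \<open>p\<close>, and \<open>k0\<close> is the value
      there.\<close>
    define x0 where "x0 = 2 * A * (\<beta> + a)"
    define k0 where "k0 = A * a\<^sup>2 + 2 * A * \<beta> * a + (A * \<beta>\<^sup>2 + \<gamma>)"
    have complete: "[f x + a * x = k0] (mod int p) \<longleftrightarrow> [x = x0] (mod int p)" for x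
    proof -
      have "[f x + a * x = \<alpha> * x\<^sup>2 + \<beta> * x + \<gamma> + a * x] (mod int p)" by (intro cong_add q cong_refl)
      then have "[f x + a * x = k0] (mod int p) \<longleftrightarrow> [\<alpha> * x\<^sup>2 + \<beta> * x + \<gamma> + a * x = k0] (mod int p)"
        using cong_sym cong_trans by blast
      also have "\<dots> \<longleftrightarrow> int p dvd \<alpha> * x\<^sup>2 + \<beta> * x + \<gamma> + a * x - k0" by (simp add: cong_iff_dvd_diff)
      also have "\<alpha> * x\<^sup>2 + \<beta> * x + \<gamma> + a * x - k0 = \<alpha> * (x - x0)\<^sup>2 + int p * (z * ((\<beta> + a) * x - A * (\<beta> + a)\<^sup>2))"
      proof -
        have "\<alpha> * (x - x0)\<^sup>2 = \<alpha> * x\<^sup>2 - (4 * \<alpha> * A) * (\<beta> + a) * x + (4 * \<alpha> * A) * A * (\<beta> + a)\<^sup>2"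
          by (simp add: x0_def algebra_simps power2_eq_square)
        then show ?thesis unfolding z k0_def by (simp add: algebra_simps power2_eq_square)
      qed
      also have "int p dvd \<dots> \<longleftrightarrow> int p dvd \<alpha> * (x - x0)\<^sup>2" by (simp add: dvd_add_left_iff)
      also have "\<dots> \<longleftrightarrow> int p dvd x - x0"
        using \<alpha> prime_int_p by (simp add: prime_dvd_mult_iff prime_dvd_power_iff)
      finally show ?thesis by (simp add: cong_iff_dvd_diff)
    qed
    have "val_count f a k0 = (\<Sum>x\<in>Zp. 1 * of_bool ([x = x0] (mod int p)))"
      unfolding val_count_def complete by simp
    also have "\<dots> = 1" by (rule sum_Zp_delta) (simp add: periodic_def)
    finally have "chi (k0 - d a) = 0" using count[of a k0] e[of a] by auto
    then have "[k0 = d a] (mod int p)" by (simp add: chi_eq_0_iff cong_iff_dvd_diff)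
    then show "[d a = A * a\<^sup>2 + 2 * A * \<beta> * a + (A * \<beta>\<^sup>2 + \<gamma>)] (mod int p)"
      unfolding k0_def by (rule cong_sym)
  qed
qed

end

section \<open>Four functions with balanced differences\<close>

text \<open>Counts the pairs, one point on the graph of \<open>f\<close> and one on the graph of
  \<open>g\<close>, with difference vector \<open>(s, b)\<close>.\<close>

definition diff_count :: "(int \<Rightarrow> int) \<Rightarrow> (int \<Rightarrow> int) \<Rightarrow> int \<Rightarrow> int \<Rightarrow> int" where
  "diff_count f g s b = (\<Sum>x\<in>Zp. of_bool ([g (x + s) = f x + b] (mod int p)))"

lemma periodic_of_bool_cong: "periodic (\<lambda>k. of_bool ([x = k] (mod int p)) :: int)"
  unfolding periodic_def using cong_trans cong_sym by (intro allI impI arg_cong[where f=of_bool]) blast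

lemma periodic_val_count: "periodic (val_count f a)"
  unfolding periodic_def val_count_def
  by (intro allI impI sum.cong refl) (rule periodicD[OF periodic_of_bool_cong])

lemma val_count_nonneg: "0 \<le> val_count f a k"
  unfolding val_count_def by (rule sum_nonneg) simp

lemma sum_mult_val_count:
  assumes "periodic F"
  shows "(\<Sum>k\<in>Zp. val_count f a k * F k) = (\<Sum>x\<in>Zp. F (f x + a * x))"
proof -
  have "(\<Sum>k\<in>Zp. val_count f a k * F k) = (\<Sum>x\<in>Zp. \<Sum>k\<in>Zp. F k * of_bool ([k = f x + a * x] (mod int p)))"
    unfolding val_count_def sum_distrib_right
    by (subst sum.swap) (simp only: mult.commute cong_sym_eq)
  then show ?thesis by (simp only: sum_Zp_delta[OF assms])
qed

lemma sum_val_count: "(\<Sum>k\<in>Zp. val_count f a k) = int p"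
  using sum_mult_val_count[of "\<lambda>_. 1" f a] by (simp add: periodic_def)

text \<open>Two graph points whose values of \<open>y + a * x\<close> differ by \<open>t\<close>
  have a difference vector \<open>(s, b)\<close> with \<open>b + a * s = t\<close>; the pairs are
  sorted by \<open>s\<close>.\<close>

lemma corr_val_count:
  assumes g: "periodic g"
  shows "corr (val_count f a) (val_count g a) t = (\<Sum>s\<in>Zp. diff_count f g s (t - a * s))"
proof -
  have "corr (val_count f a) (val_count g a) t = (\<Sum>x\<in>Zp. val_count g a (f x + a * x + t))"
    unfolding corr_def
    by (rule sum_mult_val_count) (intro periodic_shift periodic_val_count)
  also have "\<dots> = (\<Sum>x\<in>Zp. \<Sum>s\<in>Zp. of_bool ([g (x + s) = f x + (t - a * s)] (mod int p)))"
  proof (rule sum.cong[OF refl])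
    fix x
    have "periodic (\<lambda>y. of_bool ([g y + a * y = f x + a * x + t] (mod int p)) :: int)"
      unfolding periodic_def
    proof (intro allI impI arg_cong[where f=of_bool])
      fix y z assume yz: "[y = z] (mod int p)"
      then have "[g y + a * y = g z + a * z] (mod int p)"
        using periodicD[OF g yz] by (auto intro: cong_add cong_scalar_left)
      then show "[g y + a * y = f x + a * x + t] (mod int p) \<longleftrightarrow> [g z + a * z = f x + a * x + t] (mod int p)"
        using cong_sym cong_trans by blast
    qed
    from sum_shift[OF this, of x]
    have "val_count g a (f x + a * x + t)
        = (\<Sum>s\<in>Zp. of_bool ([g (s + x) + a * (s + x) = f x + a * x + t] (mod int p)))"
      unfolding val_count_def by simp
    then show "val_count g a (f x + a * x + t) = (\<Sum>s\<in>Zp. of_bool ([g (x + s) = f x + (t - a * s)] (mod int p)))"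
      by (simp add: cong_iff_dvd_diff algebra_simps)
  qed
  finally show ?thesis unfolding diff_count_def by (subst (asm) sum.swap)
qed

lemma quadratic_coeffs_dvd:
  assumes "S \<subseteq> Zp" "3 \<le> card S" "\<And>a. a \<in> S \<Longrightarrow> int p dvd A * a\<^sup>2 + B * a + C"
  shows "int p dvd A" "int p dvd B" "int p dvd C"
proof -
  have "int p dvd coeff [:C, B, A:] i" for i
    by (rule coeffs_dvd_of_many_roots[of _ 2 S])
       (use assms in \<open>auto simp: algebra_simps power2_eq_square\<close>)
  from this[of 0] this[of 1] this[of 2] show "int p dvd A" "int p dvd B" "int p dvd C"
    by (simp_all add: numeral_2_eq_2)
qed

text \<open>The coefficients of the center determine the function, since \<open>4 * A0\<close> is
  invertible modulo \<open>p\<close>.\<close>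

lemma cong_of_equal_centers:
  assumes A: "\<not> int p dvd A0"
    and coeffs: "int p dvd A0 - A1" "int p dvd B0 - B1" "int p dvd C0 - C1"
    and f: "[4 * A0 * f = 4 * A0 * C0 - (x - B0)\<^sup>2] (mod int p)"
    and g: "[4 * A1 * g = 4 * A1 * C1 - (x - B1)\<^sup>2] (mod int p)"
  shows "[f = g] (mod int p)"
proof -
  have c: "[A0 = A1] (mod int p)" "[B0 = B1] (mod int p)" "[C0 = C1] (mod int p)"
    using coeffs by (simp_all add: cong_iff_dvd_diff)
  have "[4 * A0 * C0 - (x - B0)\<^sup>2 = 4 * A1 * C1 - (x - B1)\<^sup>2] (mod int p)"
    by (intro cong_diff cong_mult cong_pow cong_refl c)
  with f have "[4 * A0 * f = 4 * A1 * C1 - (x - B1)\<^sup>2] (mod int p)" by (rule cong_trans)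
  with g have "[4 * A0 * f = 4 * A1 * g] (mod int p)" using cong_sym cong_trans by blast
  moreover have "[4 * A1 * g = 4 * A0 * g] (mod int p)"
    by (intro cong_mult cong_refl cong_sym[OF c(1)])
  ultimately have "[4 * A0 * f = 4 * A0 * g] (mod int p)" by (rule cong_trans)
  then have "int p dvd 4 * A0 * (f - g)" by (simp add: cong_iff_dvd_diff algebra_simps)
  then show ?thesis using A prime_int_p not_dvd_small[of 4] p_ge_5
    by (auto simp: prime_dvd_mult_iff cong_iff_dvd_diff)
qed

text \<open>Distinct quadratics agree in at most two points, so each of the three pairings holds at most twice.
  Two pairings together hold at three points or more, hence \<open>d 0 + d 3 = d 1 + d 2\<close> identically, and
  then every point of the third pairing already belongs to the first.\<close>

lemma quadratic_pairing_impossible: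
  fixes A B C :: "nat \<Rightarrow> int"
  defines "d \<equiv> \<lambda>i a. A i * a\<^sup>2 + B i * a + C i"
  assumes distinct: "\<And>i. i \<in> {1,2,3} \<Longrightarrow> \<not> (int p dvd A 0 - A i \<and> int p dvd B 0 - B i \<and> int p dvd C 0 - C i)"
    and pairing: "\<And>a. a \<in> Zp \<Longrightarrow> [d 0 a = d 1 a] (mod int p) \<and> [d 2 a = d 3 a] (mod int p)
       \<or> [d 0 a = d 2 a] (mod int p) \<and> [d 1 a = d 3 a] (mod int p)
       \<or> [d 0 a = d 3 a] (mod int p) \<and> [d 1 a = d 2 a] (mod int p)"
  shows False
proof -
  define S1 where "S1 = {a\<in>Zp. [d 0 a = d 1 a] (mod int p) \<and> [d 2 a = d 3 a] (mod int p)}"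
  define S2 where "S2 = {a\<in>Zp. [d 0 a = d 2 a] (mod int p) \<and> [d 1 a = d 3 a] (mod int p)}"
  define S3 where "S3 = {a\<in>Zp. [d 0 a = d 3 a] (mod int p) \<and> [d 1 a = d 2 a] (mod int p)}"
  have sub: "S1 \<subseteq> Zp" "S2 \<subseteq> Zp" "S3 \<subseteq> Zp" by (auto simp: S1_def S2_def S3_def)
  have le2: "card S \<le> 2" if "i \<in> {1,2,3}" "S \<subseteq> Zp" "\<And>a. a \<in> S \<Longrightarrow> [d 0 a = d i a] (mod int p)" for i S
  proof (rule ccontr)
    assume "\<not> card S \<le> 2"
    then have "3 \<le> card S" by simp
    moreover have "int p dvd (A 0 - A i) * a\<^sup>2 + (B 0 - B i) * a + (C 0 - C i)" if "a \<in> S" for a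
      using \<open>\<And>a. a \<in> S \<Longrightarrow> [d 0 a = d i a] (mod int p)\<close>[OF that]
      by (simp add: d_def cong_iff_dvd_diff algebra_simps)
    ultimately show False using quadratic_coeffs_dvd[OF that(2)] distinct[OF that(1)] by blast
  qed
  have "card S1 \<le> 2" by (rule le2[of 1, OF _ sub(1)]) (simp_all add: S1_def)
  moreover have "card S2 \<le> 2" by (rule le2[of 2, OF _ sub(2)]) (simp_all add: S2_def)
  moreover have "card S3 \<le> 2" by (rule le2[of 3, OF _ sub(3)]) (simp_all add: S3_def)
  ultimately have c: "card S1 \<le> 2" "card S2 \<le> 2" "card S3 \<le> 2" .
  have "Zp \<subseteq> (S1 \<union> S2) \<union> S3" using pairing unfolding S1_def S2_def S3_def by blast
  then have "Zp = (S1 \<union> S2) \<union> S3" using sub by blast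
  then have p: "card Zp \<le> card (S1 \<union> S2) + card S3" by (metis card_Un_le)
  then have "3 \<le> card (S1 \<union> S2)" using c p_ge_5 by simp
  then have D: "int p dvd A 0 + A 3 - A 1 - A 2" "int p dvd B 0 + B 3 - B 1 - B 2" "int p dvd C 0 + C 3 - C 1 - C 2"
  proof -
    have "int p dvd (A 0 + A 3 - A 1 - A 2) * a\<^sup>2 + (B 0 + B 3 - B 1 - B 2) * a + (C 0 + C 3 - C 1 - C 2)"
      if a: "a \<in> S1 \<union> S2" for a
    proof -
      have "int p dvd (d 0 a - d 1 a) - (d 2 a - d 3 a) \<or> int p dvd (d 0 a - d 2 a) - (d 1 a - d 3 a)"
        using a by (auto simp: S1_def S2_def cong_iff_dvd_diff intro: dvd_diff)
      then show ?thesis by (auto simp: d_def algebra_simps)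
    qed
    then show "int p dvd A 0 + A 3 - A 1 - A 2" "int p dvd B 0 + B 3 - B 1 - B 2" "int p dvd C 0 + C 3 - C 1 - C 2"
      using quadratic_coeffs_dvd[of "S1 \<union> S2"] sub \<open>3 \<le> card (S1 \<union> S2)\<close> by blast+
  qed
  have "S3 \<subseteq> S1 \<union> S2"
  proof
    fix a assume a: "a \<in> S3"
    have "int p dvd (A 0 + A 3 - A 1 - A 2) * a\<^sup>2 + (B 0 + B 3 - B 1 - B 2) * a + (C 0 + C 3 - C 1 - C 2)"
      using D by (intro dvd_add dvd_mult2)
    then have e: "int p dvd d 0 a + d 3 a - d 1 a - d 2 a" by (simp add: d_def algebra_simps)
    have h: "int p dvd d 0 a - d 3 a" "int p dvd d 1 a - d 2 a" using a by (auto simp: S3_def cong_iff_dvd_diff)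
    have "2 * (d 0 a - d 1 a) = (d 0 a + d 3 a - d 1 a - d 2 a) + (d 0 a - d 3 a) - (d 1 a - d 2 a)" by simp
    then have "int p dvd 2 * (d 0 a - d 1 a)" using e h by (metis dvd_add dvd_diff)
    then have 01: "int p dvd d 0 a - d 1 a" by (rule dvd_double_imp_dvd)
    have "d 2 a - d 3 a = (d 0 a - d 3 a) - (d 0 a - d 1 a) - (d 1 a - d 2 a)" by simp
    then have "int p dvd d 2 a - d 3 a" using h 01 by (metis dvd_diff)
    then show "a \<in> S1 \<union> S2" using 01 a by (auto simp: S1_def S3_def cong_iff_dvd_diff)
  qed
  then have "Zp = S1 \<union> S2" using \<open>Zp = (S1 \<union> S2) \<union> S3\<close> by blast
  then have "card Zp \<le> card S1 + card S2" by (metis card_Un_le)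
  then show False using c p_ge_5 by simp
qed

lemma diff_count_balanced_impossible:
  fixes f0 f1 f2 f3 :: "int \<Rightarrow> int"
  assumes per: "periodic f0" "periodic f1" "periodic f2" "periodic f3"
    and H0: "\<And>s b. \<not> int p dvd s \<Longrightarrow>
        diff_count f0 f0 s b + diff_count f1 f1 s b + diff_count f2 f2 s b + diff_count f3 f3 s b = 4"
    and H1: "\<And>s b. diff_count f0 f1 s b + diff_count f1 f0 s b + diff_count f2 f3 s b + diff_count f3 f2 s b = 4"
    and H2: "\<And>s b. diff_count f0 f2 s b + diff_count f2 f0 s b + diff_count f1 f3 s b + diff_count f3 f1 s b = 4"
    and H3: "\<And>s b. diff_count f0 f3 s b + diff_count f3 f0 s b + diff_count f1 f2 s b + diff_count f2 f1 s b = 4"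
  shows False
proof -
  note cv = corr_val_count[OF per(1)] corr_val_count[OF per(2)] corr_val_count[OF per(3)] corr_val_count[OF per(4)]
  have dc0: "diff_count f f 0 b = int p * of_bool (int p dvd b)" for f b
    by (simp add: diff_count_def cong_iff_dvd_diff)
  have A0: "corr (val_count f0 a) (val_count f0 a) t + corr (val_count f1 a) (val_count f1 a) t
      + corr (val_count f2 a) (val_count f2 a) t + corr (val_count f3 a) (val_count f3 a) t
      = 4 * (int p - 1) + 4 * int p * of_bool (int p dvd t)" for a t
  proof -
    have "corr (val_count f0 a) (val_count f0 a) t + corr (val_count f1 a) (val_count f1 a) t
      + corr (val_count f2 a) (val_count f2 a) t + corr (val_count f3 a) (val_count f3 a) t
      = (\<Sum>s\<in>Zp. diff_count f0 f0 s (t - a * s) + diff_count f1 f1 s (t - a * s)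
          + diff_count f2 f2 s (t - a * s) + diff_count f3 f3 s (t - a * s))"
      unfolding cv by (simp add: sum.distrib)
    \<comment> \<open>The shift \<open>s = 0\<close> lies outside \<open>H0\<close>; there each
      count is \<open>p\<close> or zero, which yields the delta term.\<close>
    also have "\<dots> = (\<Sum>s\<in>Zp. if s = 0 then 4 * int p * of_bool (int p dvd t) else 4)"
    proof (rule sum.cong[OF refl])
      fix s assume "s \<in> Zp"
      then have "s = 0 \<or> \<not> int p dvd s" using dvd_abs_less_imp_0[of s] by auto
      then show "diff_count f0 f0 s (t - a * s) + diff_count f1 f1 s (t - a * s)
          + diff_count f2 f2 s (t - a * s) + diff_count f3 f3 s (t - a * s)
          = (if s = 0 then 4 * int p * of_bool (int p dvd t) else 4)"
        using H0 by (auto simp: dc0)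
    qed
    also have "\<dots> = 4 * int p * of_bool (int p dvd t) + (\<Sum>s\<in>Zp - {0}. 4)"
      using p_ge_5 by (subst sum.remove[of _ 0]) (auto intro: sum.cong)
    also have "\<dots> = 4 * (int p - 1) + 4 * int p * of_bool (int p dvd t)" using p_ge_5 by simp
    finally show ?thesis .
  qed
  have A1: "corr (val_count f0 a) (val_count f1 a) t + corr (val_count f1 a) (val_count f0 a) t
      + corr (val_count f2 a) (val_count f3 a) t + corr (val_count f3 a) (val_count f2 a) t = 4 * int p" for a t
    unfolding cv sum.distrib[symmetric] H1 by simp
  have A2: "corr (val_count f0 a) (val_count f2 a) t + corr (val_count f2 a) (val_count f0 a) t
      + corr (val_count f1 a) (val_count f3 a) t + corr (val_count f3 a) (val_count f1 a) t = 4 * int p" for a t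
    unfolding cv sum.distrib[symmetric] H2 by simp
  have A3: "corr (val_count f0 a) (val_count f3 a) t + corr (val_count f3 a) (val_count f0 a) t
      + corr (val_count f1 a) (val_count f2 a) t + corr (val_count f2 a) (val_count f1 a) t = 4 * int p" for a t
    unfolding cv sum.distrib[symmetric] H3 by simp
  \<comment> \<open>Bundling the conclusions lets the centers and signs be chosen as functions of
    the slope \<open>a\<close>.\<close>
  define Q where "Q a d e \<longleftrightarrow> (\<forall>i<4. e i = 1 \<or> e i = (-1::int)) \<and>
      (\<forall>k. val_count f0 a k = 1 + e 0 * chi (k - d 0)) \<and> (\<forall>k. val_count f1 a k = 1 + e 1 * chi (k - d 1)) \<and>
      (\<forall>k. val_count f2 a k = 1 + e 2 * chi (k - d 2)) \<and> (\<forall>k. val_count f3 a k = 1 + e 3 * chi (k - d 3)) \<and>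
      ([d 0 = d 1] (mod int p) \<and> [d 2 = d 3] (mod int p) \<or> [d 0 = d 2] (mod int p) \<and> [d 1 = d 3] (mod int p)
       \<or> [d 0 = d 3] (mod int p) \<and> [d 1 = d 2] (mod int p))" for a and d e :: "nat \<Rightarrow> int"
  have "\<exists>d e. Q a d e" for a
  proof -
    obtain d0 d1 d2 d3 e0 e1 e2 e3 where v: "\<forall>e\<in>{e0,e1,e2,e3}. e = 1 \<or> e = -1"
      "\<And>k. val_count f0 a k = 1 + e0 * chi (k - d0)" "\<And>k. val_count f1 a k = 1 + e1 * chi (k - d1)"
      "\<And>k. val_count f2 a k = 1 + e2 * chi (k - d2)" "\<And>k. val_count f3 a k = 1 + e3 * chi (k - d3)"
      "[d0 = d1] (mod int p) \<and> [d2 = d3] (mod int p) \<or> [d0 = d2] (mod int p) \<and> [d1 = d3] (mod int p)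
       \<or> [d0 = d3] (mod int p) \<and> [d1 = d2] (mod int p)"
      by (rule value_distribution[OF periodic_val_count periodic_val_count periodic_val_count periodic_val_count
        sum_val_count sum_val_count sum_val_count sum_val_count
        val_count_nonneg val_count_nonneg val_count_nonneg val_count_nonneg A0 A1 A2 A3]) blast
    have "Q a (\<lambda>i. [d0, d1, d2, d3] ! i) (\<lambda>i. [e0, e1, e2, e3] ! i)"
      unfolding Q_def using v by (simp add: numeral_3_eq_3 numeral_2_eq_2 All_less_Suc eval_nat_numeral)
    then show ?thesis by blast
  qed
  then obtain d e where Q: "\<And>a. Q a (d a) (e a)" by metis
  have e: "e a i = 1 \<or> e a i = -1" if "i < 4" for a i using Q that unfolding Q_def by blast
  have vc: "val_count f0 a k = 1 + e a 0 * chi (k - d a 0)" "val_count f1 a k = 1 + e a 1 * chi (k - d a 1)"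
    "val_count f2 a k = 1 + e a 2 * chi (k - d a 2)" "val_count f3 a k = 1 + e a 3 * chi (k - d a 3)" for a k
    using Q[of a] unfolding Q_def by blast+
  obtain a0 b0 c0 where q0: "\<not> int p dvd a0" "\<And>a. [d a 0 = a0 * a\<^sup>2 + b0 * a + c0] (mod int p)"
    "\<And>x. [4 * a0 * f0 x = 4 * a0 * c0 - (x - b0)\<^sup>2] (mod int p)"
    using chi_distribution_center[of f0 "\<lambda>a. e a 0" "\<lambda>a. d a 0", OF per(1) e vc(1)] by auto
  obtain a1 b1 c1 where q1: "\<not> int p dvd a1" "\<And>a. [d a 1 = a1 * a\<^sup>2 + b1 * a + c1] (mod int p)"
    "\<And>x. [4 * a1 * f1 x = 4 * a1 * c1 - (x - b1)\<^sup>2] (mod int p)"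
    using chi_distribution_center[of f1 "\<lambda>a. e a 1" "\<lambda>a. d a 1", OF per(2) e vc(2)] by auto
  obtain a2 b2 c2 where q2: "\<not> int p dvd a2" "\<And>a. [d a 2 = a2 * a\<^sup>2 + b2 * a + c2] (mod int p)"
    "\<And>x. [4 * a2 * f2 x = 4 * a2 * c2 - (x - b2)\<^sup>2] (mod int p)"
    using chi_distribution_center[of f2 "\<lambda>a. e a 2" "\<lambda>a. d a 2", OF per(3) e vc(3)] by auto
  obtain a3 b3 c3 where q3: "\<not> int p dvd a3" "\<And>a. [d a 3 = a3 * a\<^sup>2 + b3 * a + c3] (mod int p)"
    "\<And>x. [4 * a3 * f3 x = 4 * a3 * c3 - (x - b3)\<^sup>2] (mod int p)"
    using chi_distribution_center[of f3 "\<lambda>a. e a 3" "\<lambda>a. d a 3", OF per(4) e vc(4)] by auto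
  have nn: "0 \<le> diff_count f g s b" for f g s b
    unfolding diff_count_def by (rule sum_nonneg) simp
  have large: "diff_count f g 0 0 = int p" if "\<And>x. [f x = g x] (mod int p)" for f g
    using that[THEN cong_sym] by (simp add: diff_count_def)
  \<comment> \<open>Equal center coefficients would make two functions agree, and a single count at
    \<open>(0, 0)\<close> would be \<open>p\<close>, more than the balanced total
    \<open>4\<close>.\<close>
  have n1: "\<not> (int p dvd a0 - a1 \<and> int p dvd b0 - b1 \<and> int p dvd c0 - c1)"
    using large[of f0 f1] cong_of_equal_centers[OF q0(1) _ _ _ q0(3) q1(3)] H1[of 0 0]
      nn[of f1 f0 0 0] nn[of f2 f3 0 0] nn[of f3 f2 0 0] p_ge_5 by force
  have n2: "\<not> (int p dvd a0 - a2 \<and> int p dvd b0 - b2 \<and> int p dvd c0 - c2)"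
    using large[of f0 f2] cong_of_equal_centers[OF q0(1) _ _ _ q0(3) q2(3)] H2[of 0 0]
      nn[of f2 f0 0 0] nn[of f1 f3 0 0] nn[of f3 f1 0 0] p_ge_5 by force
  have n3: "\<not> (int p dvd a0 - a3 \<and> int p dvd b0 - b3 \<and> int p dvd c0 - c3)"
    using large[of f0 f3] cong_of_equal_centers[OF q0(1) _ _ _ q0(3) q3(3)] H3[of 0 0]
      nn[of f3 f0 0 0] nn[of f1 f2 0 0] nn[of f2 f1 0 0] p_ge_5 by force
  define A where "A i = [a0, a1, a2, a3] ! i" for i
  define B where "B i = [b0, b1, b2, b3] ! i" for i
  define C where "C i = [c0, c1, c2, c3] ! i" for i
  have ABC: "A 0 = a0" "A 1 = a1" "A 2 = a2" "A 3 = a3" "B 0 = b0" "B 1 = b1" "B 2 = b2" "B 3 = b3"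
    "C 0 = c0" "C 1 = c1" "C 2 = c2" "C 3 = c3"
    by (simp_all add: A_def B_def C_def)
  show False
  proof (rule quadratic_pairing_impossible[of A B C])
    show "\<not> (int p dvd A 0 - A i \<and> int p dvd B 0 - B i \<and> int p dvd C 0 - C i)" if "i \<in> {1,2,3}" for i
      using that n1 n2 n3 by (auto simp only: insert_iff empty_iff ABC)
    fix a
    have tr: "[y = z] (mod int p)" if "[u = v] (mod int p)" "[u = y] (mod int p)" "[v = z] (mod int p)" for u v y z
      using that cong_sym cong_trans by blast
    have "[d a 0 = d a 1] (mod int p) \<and> [d a 2 = d a 3] (mod int p) \<or> [d a 0 = d a 2] (mod int p) \<and> [d a 1 = d a 3] (mod int p)
       \<or> [d a 0 = d a 3] (mod int p) \<and> [d a 1 = d a 2] (mod int p)"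
      using Q[of a] unfolding Q_def by blast
    then show "[A 0 * a\<^sup>2 + B 0 * a + C 0 = A 1 * a\<^sup>2 + B 1 * a + C 1] (mod int p) \<and>
         [A 2 * a\<^sup>2 + B 2 * a + C 2 = A 3 * a\<^sup>2 + B 3 * a + C 3] (mod int p) \<or>
         [A 0 * a\<^sup>2 + B 0 * a + C 0 = A 2 * a\<^sup>2 + B 2 * a + C 2] (mod int p) \<and>
         [A 1 * a\<^sup>2 + B 1 * a + C 1 = A 3 * a\<^sup>2 + B 3 * a + C 3] (mod int p) \<or>
         [A 0 * a\<^sup>2 + B 0 * a + C 0 = A 3 * a\<^sup>2 + B 3 * a + C 3] (mod int p) \<and>
         [A 1 * a\<^sup>2 + B 1 * a + C 1 = A 2 * a\<^sup>2 + B 2 * a + C 2] (mod int p)"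
      unfolding ABC
      using tr[OF _ q0(2) q1(2), of a] tr[OF _ q2(2) q3(2), of a] tr[OF _ q0(2) q2(2), of a]
        tr[OF _ q1(2) q3(2), of a] tr[OF _ q0(2) q3(2), of a] tr[OF _ q1(2) q2(2), of a] by blast
  qed
qed

section \<open>Relative difference sets as graphs\<close>

abbreviation "G \<equiv> Z22_Zpp p"

lemma carrier_G: "carrier G = ({0..<2} \<times> {0..<2}) \<times> (Zp \<times> Zp)"
  using p_ge_5 by (simp add: Z22_Zpp_def carrier_integer_mod_group)

lemma mult_G: "((a, b), (x, y)) \<otimes>\<^bsub>G\<^esub> ((a', b'), (x', y'))
    = (((a + a') mod 2, (b + b') mod 2), ((x + x') mod int p, (y + y') mod int p))"
  by (simp add: Z22_Zpp_def)

lemma one_G: "\<one>\<^bsub>G\<^esub> = ((0, 0), (0, 0))"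
  by (simp add: Z22_Zpp_def)

lemma pow_G: "((a, b), (x, y)) [^]\<^bsub>G\<^esub> n
    = ((int n * a mod 2, int n * b mod 2), (int n * x mod int p, int n * y mod int p))"
  by (induction n) (simp_all add: mult_G one_G nat_pow_def mod_simps algebra_simps)

text \<open>The order of a non-identity element of \<open>N\<close> divides the odd number
  \<open>p\<close>, so its components modulo \<open>2\<close> vanish, and its \<open>p\<close>
  distinct multiples exhaust \<open>N\<close>.\<close>

lemma subgroup_of_order_p:
  assumes N: "subgroup N G" "card N = p"
  obtains s t where "\<not> (int p dvd s \<and> int p dvd t)"
    "N = (\<lambda>k. ((0, 0), (k * s mod int p, k * t mod int p))) ` Zp"
proof -
  interpret group G by (rule group_Z22_Zpp)
  have fin: "finite N" using N(2) p_ge_5 card_ge_0_finite by force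
  have "\<one>\<^bsub>G\<^esub> \<in> N" using N(1) by (rule subgroup.one_closed)
  moreover have "N \<noteq> {x}" for x
  proof
    assume "N = {x}"
    then have "card N = 1" by simp
    then show False using N(2) p_ge_5 by simp
  qed
  ultimately obtain n where n: "n \<in> N" "n \<noteq> \<one>\<^bsub>G\<^esub>" by blast
  obtain a b s t where n_eq: "n = ((a, b), (s, t))" by (metis surj_pair)
  have "n \<in> carrier G" using n(1) N(1) subgroup.mem_carrier by metis
  then have car: "a \<in> {0,1}" "b \<in> {0,1}" "s \<in> Zp" "t \<in> Zp" by (auto simp: carrier_G n_eq)
  have pw: "n [^]\<^bsub>G\<^esub> k \<in> N" for k :: nat
    by (induction k) (auto simp: subgroup.one_closed[OF N(1)] intro: subgroup.m_closed[OF N(1)] n(1))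
  have "group (G\<lparr>carrier := N\<rparr>)" by (rule subgroup_imp_group[OF N(1)])
  from group.pow_order_eq_1[OF this, of n] n(1) have "n [^]\<^bsub>G\<^esub> p = \<one>\<^bsub>G\<^esub>"
    by (simp add: Coset.order_def N(2) nat_pow_consistent[symmetric])
  then have "int p * a mod 2 = 0" "int p * b mod 2 = 0" by (simp_all add: n_eq pow_G one_G)
  moreover have "odd p" by (subst p_eq) simp
  ultimately have "a = 0" "b = 0" using car(1,2) by (auto simp: mod_simps)
  then have n_eq: "n = ((0, 0), (s, t))" by (simp add: n_eq)
  have nz: "\<not> (int p dvd s \<and> int p dvd t)"
    using n(2) car(3,4) dvd_abs_less_imp_0[of s] dvd_abs_less_imp_0[of t] by (auto simp: n_eq one_G)
  define h where "h k = ((0::int, 0::int), (k * s mod int p, k * t mod int p))" for k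
  have "inj_on h Zp"
  proof (rule inj_onI)
    fix k l assume kl: "k \<in> Zp" "l \<in> Zp" "h k = h l"
    then have "int p dvd (k - l) * s" "int p dvd (k - l) * t"
      by (simp_all add: h_def mod_eq_dvd_iff left_diff_distrib)
    then have "int p dvd k - l" using nz prime_int_p prime_dvd_mult_iff by blast
    then show "k = l" using kl by (intro Zp_cong_eq) (auto simp: cong_iff_dvd_diff)
  qed
  then have "card (h ` Zp) = p" by (simp add: card_image)
  moreover have "h ` Zp \<subseteq> N"
  proof
    fix g assume "g \<in> h ` Zp"
    then obtain k where k: "k \<in> Zp" "g = h k" by blast
    have "h k = n [^]\<^bsub>G\<^esub> nat k" using k(1) by (simp add: h_def n_eq pow_G)
    then show "g \<in> N" using pw k(2) by simp
  qed
  ultimately have "h ` Zp = N" using fin N(2) by (intro card_subset_eq) auto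
  then show ?thesis using that[OF nz] unfolding h_def by blast
qed

text \<open>Completes \<open>(s, t)\<close> to a basis of determinant one, with
  \<open>(w, -u)\<close> as the other vector.\<close>

lemma unimodular_completion:
  assumes "\<not> (int p dvd s \<and> int p dvd t)"
  obtains u w where "[t * w + s * u = 1] (mod int p)"
proof (cases "int p dvd t")
  case False
  then obtain w where "[t * w = 1] (mod int p)" using inverse_mod_p by blast
  then show ?thesis using that[of w 0] by simp
next
  case True
  then obtain u where "[s * u = 1] (mod int p)" using inverse_mod_p assms by blast
  then show ?thesis using that[of 0 u] by simp
qed

text \<open>For \<open>t * w + s * u = 1\<close> these are coordinates in which the line through \<open>(s, t)\<close> is \<open>x = 0\<close>.\<close>

definition coord :: "int \<Rightarrow> int \<Rightarrow> int \<Rightarrow> int \<Rightarrow> int \<Rightarrow> int \<Rightarrow> int \<Rightarrow> int \<Rightarrow> (int \<times> int) \<times> (int \<times> int)" where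
  "coord s t u w i j x y = ((i mod 2, j mod 2), ((w * x + s * y) mod int p, (t * y - u * x) mod int p))"

context
  fixes s t u w :: int and \<phi> :: "int \<Rightarrow> int \<Rightarrow> int \<Rightarrow> int \<Rightarrow> (int \<times> int) \<times> (int \<times> int)"
  assumes det: "[t * w + s * u = 1] (mod int p)"
  defines "\<phi> \<equiv> coord s t u w"
begin

lemma \<phi>_in_carrier: "\<phi> i j x y \<in> carrier G"
  using p_ge_5 by (auto simp: \<phi>_def coord_def carrier_G)

lemma \<phi>_mult: "\<phi> i j x y \<otimes>\<^bsub>G\<^esub> \<phi> i' j' x' y' = \<phi> (i + i') (j + j') (x + x') (y + y')"
  by (simp add: \<phi>_def coord_def mult_G mod_add_eq) (simp add: algebra_simps)

lemma \<phi>_eq_iff: "\<phi> i j x y = \<phi> i' j' x' y' \<longleftrightarrow>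
    i mod 2 = i' mod 2 \<and> j mod 2 = j' mod 2 \<and> [x = x'] (mod int p) \<and> [y = y'] (mod int p)"
proof
  assume "\<phi> i j x y = \<phi> i' j' x' y'"
  then have ij: "i mod 2 = i' mod 2" "j mod 2 = j' mod 2"
    and 1: "[w * x + s * y = w * x' + s * y'] (mod int p)"
    and 2: "[t * y - u * x = t * y' - u * x'] (mod int p)"
    by (simp_all add: \<phi>_def coord_def cong_def)
  \<comment> \<open>Cramer's rule: this combination and the next isolate \<open>x\<close> and
    \<open>y\<close> up to the determinant.\<close>
  have "[t * (w * x + s * y) - s * (t * y - u * x) = t * (w * x' + s * y') - s * (t * y' - u * x')] (mod int p)"
    by (intro cong_diff cong_scalar_left 1 2)
  then have X: "[(t * w + s * u) * x = (t * w + s * u) * x'] (mod int p)" by (simp add: algebra_simps)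
  have "[u * (w * x + s * y) + w * (t * y - u * x) = u * (w * x' + s * y') + w * (t * y' - u * x')] (mod int p)"
    by (intro cong_add cong_scalar_left 1 2)
  then have Y: "[(t * w + s * u) * y = (t * w + s * u) * y'] (mod int p)" by (simp add: algebra_simps)
  have "[1 * z = (t * w + s * u) * z] (mod int p)" for z by (intro cong_scalar_right cong_sym[OF det])
  then have "[z = z'] (mod int p)" if "[(t * w + s * u) * z = (t * w + s * u) * z'] (mod int p)" for z z'
    using that cong_sym cong_trans by (metis mult_1)
  then show "i mod 2 = i' mod 2 \<and> j mod 2 = j' mod 2 \<and> [x = x'] (mod int p) \<and> [y = y'] (mod int p)"
    using ij X Y by blast
next
  assume h: "i mod 2 = i' mod 2 \<and> j mod 2 = j' mod 2 \<and> [x = x'] (mod int p) \<and> [y = y'] (mod int p)"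
  then have "[w * x + s * y = w * x' + s * y'] (mod int p)" "[t * y - u * x = t * y' - u * x'] (mod int p)"
    by (auto intro!: cong_add cong_diff cong_scalar_left)
  then show "\<phi> i j x y = \<phi> i' j' x' y'" using h by (simp add: \<phi>_def coord_def cong_def)
qed

lemma \<phi>_surj:
  assumes "g \<in> carrier G"
  obtains i j x y where "i \<in> {0,1}" "j \<in> {0,1}" "x \<in> Zp" "g = \<phi> i j x y"
proof -
  obtain i j a b where g: "g = ((i, j), (a, b))" by (metis surj_pair)
  have car: "i \<in> {0,1}" "j \<in> {0,1}" "a \<in> Zp" "b \<in> Zp" using assms by (auto simp: carrier_G g)
  define x where "x = (t * a - s * b) mod int p"
  have x: "[x = t * a - s * b] (mod int p)" by (simp add: x_def cong_def)
  have "[w * x + s * (u * a + w * b) = w * (t * a - s * b) + s * (u * a + w * b)] (mod int p)"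
    by (intro cong_add cong_scalar_left x cong_refl)
  also have "w * (t * a - s * b) + s * (u * a + w * b) = (t * w + s * u) * a" by (simp add: algebra_simps)
  also have "[\<dots> = 1 * a] (mod int p)" by (intro cong_scalar_right det)
  finally have 1: "(w * x + s * (u * a + w * b)) mod int p = a" using car(3) by (simp add: cong_def)
  have "[t * (u * a + w * b) - u * x = t * (u * a + w * b) - u * (t * a - s * b)] (mod int p)"
    by (intro cong_diff cong_scalar_left x cong_refl)
  also have "t * (u * a + w * b) - u * (t * a - s * b) = (t * w + s * u) * b" by (simp add: algebra_simps)
  also have "[\<dots> = 1 * b] (mod int p)" by (intro cong_scalar_right det)
  finally have 2: "(t * (u * a + w * b) - u * x) mod int p = b" using car(4) by (simp add: cong_def)
  show ?thesis
  proof (rule that[OF car(1,2)])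
    show "x \<in> Zp" by (simp only: x_def mod_in_Zp)
    show "g = \<phi> i j x (u * a + w * b)" using car(1,2) 1 2 by (auto simp: \<phi>_def coord_def g)
  qed
qed

text \<open>Two elements of \<open>R\<close> in one coset of \<open>N\<close> would have a forbidden
  quotient, and there are as many cosets as elements of \<open>R\<close>, namely
  \<open>4 * p\<close>. Hence \<open>R\<close> meets every coset exactly once.\<close>

lemma relative_difference_set_as_graph:
  assumes R: "relative_difference_set G N (4 * p) p (4 * p) 4 R"
    and N: "N = (\<lambda>k. ((0, 0), (k * s mod int p, k * t mod int p))) ` Zp"
  obtains f where "\<And>i j x y. \<phi> i j x y \<in> R \<longleftrightarrow> [y = f i j x] (mod int p)"
proof -
  have RG: "R \<subseteq> carrier G" and cR: "card R = 4 * p"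
    and forb: "\<And>g. g \<in> N - {\<one>\<^bsub>G\<^esub>} \<Longrightarrow> \<not> (\<exists>r1 \<in> R. \<exists>r2 \<in> R. g = r1 \<otimes>\<^bsub>G\<^esub> inv\<^bsub>G\<^esub> r2)"
    using R unfolding relative_difference_set_def by auto
  interpret group G by (rule group_Z22_Zpp)
  have \<phi>N: "\<phi> 0 0 0 y \<in> N" for y
    unfolding N by (rule image_eqI[of _ _ "y mod int p"]) (simp_all add: \<phi>_def coord_def mod_simps mult.commute, use p_ge_5 in auto)
  have uniq: "[y = y'] (mod int p)" if "\<phi> i j x y \<in> R" "\<phi> i j x y' \<in> R" for i j x y y'
  proof (rule ccontr)
    assume ne: "\<not> [y = y'] (mod int p)"
    have "\<phi> i j x y = \<phi> 0 0 0 (y - y') \<otimes>\<^bsub>G\<^esub> \<phi> i j x y'" by (simp add: \<phi>_mult)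
    then have "\<phi> 0 0 0 (y - y') = \<phi> i j x y \<otimes>\<^bsub>G\<^esub> inv\<^bsub>G\<^esub> \<phi> i j x y'"
      by (subst inv_solve_right) (simp_all add: \<phi>_in_carrier)
    moreover have "\<phi> 0 0 0 (y - y') \<noteq> \<one>\<^bsub>G\<^esub>"
    proof -
      have "\<one>\<^bsub>G\<^esub> = \<phi> 0 0 0 0" by (simp add: \<phi>_def coord_def one_G)
      then show ?thesis using ne by (simp add: \<phi>_eq_iff cong_iff_dvd_diff)
    qed
    ultimately show False using forb[of "\<phi> 0 0 0 (y - y')"] \<phi>N that by blast
  qed
  \<comment> \<open>\<open>T\<close> indexes the cosets that meet \<open>R\<close>; as
    \<open>R\<close> injects into it, counting shows that it contains all of them.\<close>
  define T where "T = {(i, j, x). i \<in> {0,1::int} \<and> j \<in> {0,1::int} \<and> x \<in> Zp \<and> (\<exists>y. \<phi> i j x y \<in> R)}"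
  have T_sub: "T \<subseteq> {0,1} \<times> {0,1} \<times> Zp" by (auto simp: T_def)
  have finT: "finite T" by (rule finite_subset[OF T_sub]) simp
  define \<psi> where "\<psi> = (\<lambda>(i, j, x). SOME r. r \<in> R \<and> (\<exists>y. r = \<phi> i j x y))"
  have "R \<subseteq> \<psi> ` T"
  proof
    fix r assume r: "r \<in> R"
    then obtain i j x y where ij: "i \<in> {0,1}" "j \<in> {0,1}" "x \<in> Zp" "r = \<phi> i j x y"
      using \<phi>_surj RG by blast
    have "(i, j, x) \<in> T" using ij r by (auto simp: T_def)
    moreover have "\<psi> (i, j, x) = r"
      unfolding \<psi>_def prod.case
    proof (rule some_equality)
      show "r \<in> R \<and> (\<exists>y. r = \<phi> i j x y)" using r ij by blast
      fix r' assume "r' \<in> R \<and> (\<exists>y. r' = \<phi> i j x y)"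
      then obtain y' where "r' \<in> R" "r' = \<phi> i j x y'" by blast
      then show "r' = r" using uniq[of i j x y y'] r ij(4) by (simp add: \<phi>_eq_iff cong_sym)
    qed
    ultimately show "r \<in> \<psi> ` T" by (metis imageI)
  qed
  then have "card R \<le> card T" using finT surj_card_le by blast
  moreover have "card ({0,1::int} \<times> {0,1::int} \<times> Zp) = 4 * p" by (simp add: card_cartesian_product)
  ultimately have "T = {0,1} \<times> {0,1} \<times> Zp"
    using T_sub cR by (intro card_seteq) auto
  then have ex0: "\<exists>y. \<phi> i j x y \<in> R" if "i \<in> {0,1}" "j \<in> {0,1}" "x \<in> Zp" for i j x
    using that unfolding T_def by blast
  have ex: "\<exists>y. \<phi> i j x y \<in> R" for i j x
  proof -
    have "i mod 2 \<in> {0,1}" "j mod 2 \<in> {0,1}" by auto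
    then obtain y where "\<phi> (i mod 2) (j mod 2) (x mod int p) y \<in> R" using ex0 mod_in_Zp by meson
    moreover have "\<phi> (i mod 2) (j mod 2) (x mod int p) y = \<phi> i j x y" by (simp add: \<phi>_eq_iff cong_def)
    ultimately show ?thesis by auto
  qed
  define f where "f i j x = (SOME y. \<phi> i j x y \<in> R)" for i j x
  have f: "\<phi> i j x (f i j x) \<in> R" for i j x unfolding f_def by (rule someI_ex[OF ex])
  have "\<phi> i j x y \<in> R \<longleftrightarrow> [y = f i j x] (mod int p)" for i j x y
  proof
    assume "\<phi> i j x y \<in> R" then show "[y = f i j x] (mod int p)" using uniq f by blast
  next
    assume "[y = f i j x] (mod int p)"
    then have "\<phi> i j x y = \<phi> i j x (f i j x)" by (simp add: \<phi>_eq_iff)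
    then show "\<phi> i j x y \<in> R" using f by simp
  qed
  then show ?thesis using that by blast
qed

text \<open>A representation of \<open>g\<close> is determined by \<open>r2\<close>, the only
  condition being that the translate of \<open>r2\<close> by \<open>g\<close> lies in
  \<open>R\<close> again. In graph coordinates this is the congruence that \<open>diff_count\<close>
  counts.\<close>

lemma diff_count_sum_eq_4:
  assumes R: "relative_difference_set G N (4 * p) p (4 * p) 4 R"
    and N: "N = (\<lambda>k. ((0, 0), (k * s mod int p, k * t mod int p))) ` Zp"
    and f: "\<And>i j x y. \<phi> i j x y \<in> R \<longleftrightarrow> [y = f i j x] (mod int p)"
    and ne: "\<not> (even a \<and> even b \<and> int p dvd z)"
  shows "(\<Sum>i\<in>{0,1}. \<Sum>j\<in>{0,1}. diff_count (f i j) (f (i + a) (j + b)) z c) = 4"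
proof -
  interpret group G by (rule group_Z22_Zpp)
  have RG: "R \<subseteq> carrier G"
    and rep: "\<And>g. g \<in> carrier G - N \<Longrightarrow> card {(r1, r2). r1 \<in> R \<and> r2 \<in> R \<and> g = r1 \<otimes>\<^bsub>G\<^esub> inv\<^bsub>G\<^esub> r2} = 4"
    using R unfolding relative_difference_set_def by auto
  define g where "g = \<phi> a b z c"
  have "g \<notin> N"
  proof
    assume "g \<in> N"
    then obtain k where "g = ((0, 0), (k * s mod int p, k * t mod int p))" unfolding N by blast
    then have "\<phi> a b z c = \<phi> 0 0 0 k" by (simp add: \<phi>_def coord_def g_def mult.commute)
    then show False using ne by (auto simp: \<phi>_eq_iff cong_0_iff even_iff_mod_2_eq_zero)
  qed
  then have card4: "card {(r1, r2). r1 \<in> R \<and> r2 \<in> R \<and> g = r1 \<otimes>\<^bsub>G\<^esub> inv\<^bsub>G\<^esub> r2} = 4"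
    by (intro rep) (simp add: g_def \<phi>_in_carrier)
  define B where "B = {0,1::int} \<times> {0,1::int} \<times> Zp"
  define T where "T = {(i, j, x) \<in> B. [f (i + a) (j + b) (x + z) = f i j x + c] (mod int p)}"
  define \<psi> where "\<psi> = (\<lambda>(i, j, x). (g \<otimes>\<^bsub>G\<^esub> \<phi> i j x (f i j x), \<phi> i j x (f i j x)))"
  have g\<phi>: "g \<otimes>\<^bsub>G\<^esub> \<phi> i j x (f i j x) = \<phi> (i + a) (j + b) (x + z) (f i j x + c)" for i j x
    by (simp add: g_def \<phi>_mult add.commute)
  have solve: "g = r1 \<otimes>\<^bsub>G\<^esub> inv\<^bsub>G\<^esub> r2 \<longleftrightarrow> r1 = g \<otimes>\<^bsub>G\<^esub> r2" if "r1 \<in> R" "r2 \<in> R" for r1 r2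
    using that RG by (subst inv_solve_right) (auto simp: g_def \<phi>_in_carrier)
  have inj: "inj_on \<psi> T"
  proof (rule inj_onI)
    fix v v' assume v: "v \<in> T" "v' \<in> T" "\<psi> v = \<psi> v'"
    obtain i j x where 1: "v = (i, j, x)" by (metis surj_pair)
    obtain i' j' x' where 2: "v' = (i', j', x')" by (metis surj_pair)
    have "\<phi> i j x (f i j x) = \<phi> i' j' x' (f i' j' x')" using v(3) by (simp add: \<psi>_def 1 2)
    then have "i mod 2 = i' mod 2" "j mod 2 = j' mod 2" "[x = x'] (mod int p)" by (simp_all add: \<phi>_eq_iff)
    moreover have "x \<in> Zp" "x' \<in> Zp" "i \<in> {0,1}" "i' \<in> {0,1}" "j \<in> {0,1}" "j' \<in> {0,1}"
      using v(1,2) by (auto simp: T_def B_def 1 2)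
    ultimately show "v = v'" using Zp_cong_eq by (auto simp: 1 2)
  qed
  have "\<psi> ` T = {(r1, r2). r1 \<in> R \<and> r2 \<in> R \<and> g = r1 \<otimes>\<^bsub>G\<^esub> inv\<^bsub>G\<^esub> r2}"
  proof (intro equalityI subsetI)
    fix q assume "q \<in> \<psi> ` T"
    then obtain i j x where x: "(i, j, x) \<in> T" "q = \<psi> (i, j, x)" by (metis imageE surj_pair)
    have "[f i j x + c = f (i + a) (j + b) (x + z)] (mod int p)" using x(1) by (auto simp: T_def intro: cong_sym)
    then have "g \<otimes>\<^bsub>G\<^esub> \<phi> i j x (f i j x) \<in> R" unfolding g\<phi> f .
    moreover have "\<phi> i j x (f i j x) \<in> R" by (simp add: f)
    ultimately show "q \<in> {(r1, r2). r1 \<in> R \<and> r2 \<in> R \<and> g = r1 \<otimes>\<^bsub>G\<^esub> inv\<^bsub>G\<^esub> r2}"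
      using solve by (simp add: x(2) \<psi>_def)
  next
    fix q assume "q \<in> {(r1, r2). r1 \<in> R \<and> r2 \<in> R \<and> g = r1 \<otimes>\<^bsub>G\<^esub> inv\<^bsub>G\<^esub> r2}"
    then obtain r1 r2 where q: "q = (r1, r2)" "r1 \<in> R" "r2 \<in> R" "g = r1 \<otimes>\<^bsub>G\<^esub> inv\<^bsub>G\<^esub> r2" by blast
    then have r1: "r1 = g \<otimes>\<^bsub>G\<^esub> r2" using solve by blast
    obtain i j x y where ij: "i \<in> {0,1}" "j \<in> {0,1}" "x \<in> Zp" "r2 = \<phi> i j x y"
      using \<phi>_surj q(3) RG by blast
    then have r2: "r2 = \<phi> i j x (f i j x)" using q(3) f by (simp add: \<phi>_eq_iff)
    then have "\<phi> (i + a) (j + b) (x + z) (f i j x + c) \<in> R" using q(2) r1 g\<phi> by simp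
    then have "[f (i + a) (j + b) (x + z) = f i j x + c] (mod int p)" unfolding f by (rule cong_sym)
    then have "(i, j, x) \<in> T" using ij by (auto simp: T_def B_def)
    moreover have "q = \<psi> (i, j, x)" using r1 r2 by (simp add: q(1) \<psi>_def)
    ultimately show "q \<in> \<psi> ` T" by blast
  qed
  then have "card T = 4" using card4 card_image[OF inj] by simp
  have finB: "finite B" by (simp add: B_def)
  have "int (card T) = (\<Sum>v\<in>B. of_bool (v \<in> T))"
  proof -
    have "B \<inter> {v. v \<in> T} = T" by (auto simp: T_def)
    then show ?thesis using finB by simp
  qed
  also have "\<dots> = (\<Sum>(i, j, x)\<in>B. of_bool ([f (i + a) (j + b) (x + z) = f i j x + c] (mod int p)))"
    by (rule sum.cong) (auto simp: T_def)
  also have "\<dots> = (\<Sum>i\<in>{0,1}. \<Sum>j\<in>{0,1}. diff_count (f i j) (f (i + a) (j + b)) z c)"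
    unfolding B_def diff_count_def by (simp only: sum.cartesian_product[symmetric] prod.case)
  finally show ?thesis using \<open>card T = 4\<close> by simp
qed

end

lemma no_relative_difference_set:
  assumes "subgroup N G" "card N = p" "relative_difference_set G N (4 * p) p (4 * p) 4 R"
  shows False
proof -
  obtain s t where st: "\<not> (int p dvd s \<and> int p dvd t)"
    and N: "N = (\<lambda>k. ((0, 0), (k * s mod int p, k * t mod int p))) ` Zp"
    using subgroup_of_order_p[OF assms(1,2)] by blast
  obtain u w where det: "[t * w + s * u = 1] (mod int p)" using unimodular_completion[OF st] by blast
  define \<phi> where "\<phi> = coord s t u w"
  obtain f where f: "\<And>i j x y. \<phi> i j x y \<in> R \<longleftrightarrow> [y = f i j x] (mod int p)"
    unfolding \<phi>_def by (rule relative_difference_set_as_graph[OF det assms(3) N]) blast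
  \<comment> \<open>The graph description fixes values only up to congruence; after reduction,
    congruent arguments give equal values, as periodicity demands.\<close>
  define f' where "f' i j x = f i j x mod int p" for i j x
  have f': "\<phi> i j x y \<in> R \<longleftrightarrow> [y = f' i j x] (mod int p)" for i j x y
    unfolding f by (simp add: f'_def cong_def)
  have inv: "f' i j x = f' i' j' x'" if "i mod 2 = i' mod 2" "j mod 2 = j' mod 2" "[x = x'] (mod int p)" for i j x i' j' x'
  proof -
    have "\<phi> i j x (f' i j x) \<in> R" by (simp add: f')
    also have "\<phi> i j x (f' i j x) = \<phi> i' j' x' (f' i j x)"
      unfolding \<phi>_def \<phi>_eq_iff[OF det] using that by simp
    finally have "[f' i j x = f' i' j' x'] (mod int p)" unfolding f' .
    then show ?thesis by (simp add: f'_def cong_def)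
  qed
  have per: "periodic (f' i j)" for i j unfolding periodic_def using inv by blast
  have D: "(\<Sum>i\<in>{0,1}. \<Sum>j\<in>{0,1}. diff_count (f' i j) (f' (i + a) (j + b)) z c) = 4"
    if "\<not> (even a \<and> even b \<and> int p dvd z)" for a b z c
    by (rule diff_count_sum_eq_4[OF det assms(3) N f'[unfolded \<phi>_def] that])
  \<comment> \<open>The index \<open>1 + 1\<close> wraps around in the factors of order two.\<close>
  have two: "f' 2 j = f' 0 j" "f' i 2 = f' i 0" for i j using inv by auto
  show False
  proof (rule diff_count_balanced_impossible[of "f' 0 0" "f' 0 1" "f' 1 0" "f' 1 1"])
    fix z c
    show "diff_count (f' 0 0) (f' 0 0) z c + diff_count (f' 0 1) (f' 0 1) z c
        + diff_count (f' 1 0) (f' 1 0) z c + diff_count (f' 1 1) (f' 1 1) z c = 4" if "\<not> int p dvd z"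
      using D[of 0 0 z c] that by simp
    show "diff_count (f' 0 0) (f' 0 1) z c + diff_count (f' 0 1) (f' 0 0) z c
        + diff_count (f' 1 0) (f' 1 1) z c + diff_count (f' 1 1) (f' 1 0) z c = 4"
      using D[of 0 1 z c] by (simp add: two)
    show "diff_count (f' 0 0) (f' 1 0) z c + diff_count (f' 1 0) (f' 0 0) z c
        + diff_count (f' 0 1) (f' 1 1) z c + diff_count (f' 1 1) (f' 0 1) z c = 4"
      using D[of 1 0 z c] by (simp add: two)
    show "diff_count (f' 0 0) (f' 1 1) z c + diff_count (f' 1 1) (f' 0 0) z c
        + diff_count (f' 0 1) (f' 1 0) z c + diff_count (f' 1 0) (f' 0 1) z c = 4"
      using D[of 1 1 z c] by (simp add: two)
  qed (rule per)+
qed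

end

theorem theorem4p1:
  fixes p :: nat
  assumes "prime p" and "p \<ge> 5"
  shows "\<not> (\<exists>N R. subgroup N (Z22_Zpp p) \<and> card N = p \<and>
            relative_difference_set (Z22_Zpp p) N (4 * p) p (4 * p) 4 R)"
proof -
  interpret prime_ge_5 p by unfold_locales (use assms in auto)
  show ?thesis using no_relative_difference_set by blast
qed

end
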